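(* Let $\Sigma$ be a finite nonempty alphabet and let $\mathrm{TM}$ be a deterministic Turing machine with input alphabet $\Sigma$. Then there exists a sentence $\varphi_{\mathrm{TM}}$ of $\mathcal{L}(\mathcal{M}(\Sigma))$ such that: (1) for all $w\in\Sigma^*$, $\mathcal{M}(w)\models^+\varphi_{\mathrm{TM}}$ if and only if $\mathrm{TM}$ halts in an accepting state on input $w$; (2) for all $w\in\Sigma^*$, $\mathcal{M}(w)\models^-\varphi_{\mathrm{TM}}$ if and only if $\mathrm{TM}$ halts in a rejecting state on input $w$.
   Context: Turing machines are standard deterministic single-tape machines with an input alphabet $\Sigma$ and possibly an additional disjoint finite tape alphabet; "accepting" means halting in an accepting state, "rejecting" means halting in a rejecting (non-accepting) state. Word models. For a finite nonempty alphabet $\Sigma$, $\mathcal{M}(\Sigma)$ is the vocabulary $\{\mathit{Succ}\}\cup\{P_a\mid a\in\Sigma\}$ with $\mathit{Succ}$ binary and each $P_a$ unary. For $w=a_1\cdots a_n\in\Sigma^*$, $\mathcal{M}(w)$ is the model with domain $\{0,\dots,n\}$, $\mathit{Succ}$ the successor relation $\{(i,i+1)\mid 0\le i<n\}$, and $P_a=\{i\ge1\mid a_i=a\}$ (so $0$ is in no $P_a$; the empty word corresponds to the one-element model). The logic $\mathcal{L}(\sigma)$ (for a relational vocabulary $\sigma$). There are first-order variables $x,y,\dots$ and, for each $k\ge1$, countably many $k$-ary relation variables $X$. Formulae of $\mathcal{L}^*(\sigma)$ are built by: atoms $R(x_1,\dots,x_k)$ ($R\in\sigma$ $k$-ary),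 $X(x_1,\dots,x_k)$ ($X$ a $k$-ary relation variable), $x=y$, and $k$ for each natural number $k$ (a "jump atom"); and if $\varphi,\psi$ are formulae then so are $\neg\varphi$, $(\varphi\wedge\psi)$, $\exists x\,\varphi$, $Ix\,\varphi$, $I_{Rx_1\dots x_k}\varphi$, $I_{Xx_1\dots x_k}\varphi$, $D_{Rx_1\dots x_k}\varphi$, $D_{Xx_1\dots x_k}\varphi$ (for $R\in\sigma$ or $X$ a relation variable, $k$-ary), and $k\varphi$ for $k\in\mathbb{N}$. Every occurrence of a subformula counts as a distinct subformula. A formula has a non-standard jump if it contains an atomic subformula (occurrence) $k$ and a subformula $k\psi$ such that this occurrence of $k$ is not a subformula of $k\psi$; $\mathcal{L}(\sigma)$ is the set of formulae of $\mathcal{L}^*(\sigma)$ without non-standard jumps. Free variables are defined as usual, where $\exists x$ and $Ix$ bind $x$, $I_{Rx_1\dots x_k}$ and $D_{Rx_1\dots x_k}$ bind $x_1,\dots,x_k$, $I_{Xx_1\dots x_k}$ and $D_{Xx_1\dots x_k}$ bind $X,x_1,\dots,x_k$, jump atoms $k$ have no free variables, $X(x_1,\dots,x_k)$ has free variables $X,x_1,\dots,x_k$, and $k\varphi$ has the free variables of $\varphi$. A sentence has no free variables. Semantics. For a $\sigma$-model $\mathfrak{A}$, an assignment $f$ (of elements to first-order variables and $k$-ary relations on the domain to $k$-ary relation variables) covering the free variables of $\varphi$, and $\#\in\{+,-\}$, the game $G(\mathfrak{A},f,\#,\varphi)$ between players $\exists$ and $\forall$ has positions $(\mathfrak{B},g,\#',\psi)$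 and starts at $(\mathfrak{A},f,\#,\varphi)$. Call the "verifier" at a position $\exists$ if $\#'=+$ and $\forall$ if $\#'=-$, and the other player the "falsifier". Moves: from $\neg\psi$ go to $(\mathfrak{B},g,\#'',\psi)$ with $\#''$ the opposite sign; from $(\psi\wedge\psi')$ the falsifier picks one conjunct; from $\exists x\psi$ the verifier picks $b\in B$ and play goes to $(\mathfrak{B},g[x\mapsto b],\#',\psi)$; from $Ix\,\psi$ play goes to $(\mathfrak{C},g[x\mapsto b],\#',\psi)$ where $\mathfrak{C}$ is $\mathfrak{B}$ with one fresh isolated element $b$ added to the domain (all relations unchanged); from $I_{Rx_1\dots x_k}\psi$ (resp. $D_{Rx_1\dots x_k}\psi$) the verifier picks $(b_1,\dots,b_k)\in B^k$ and play goes to $(\mathfrak{B}^*,g[x_1\mapsto b_1,\dots,x_k\mapsto b_k],\#',\psi)$ where $\mathfrak{B}^*$ is $\mathfrak{B}$ with $(b_1,\dots,b_k)$ added to (resp. removed from) $R$; from $I_{Xx_1\dots x_k}\psi$ (resp. $D_{Xx_1\dots x_k}\psi$) the verifier picks $(b_1,\dots,b_k)\in B^k$ and play goes to $(\mathfrak{B},g[x_1\mapsto b_1,\dots,x_k\mapsto b_k,X\mapsto C\cup\{(b_1,\dots,b_k)\}],\#',\psi)$ (resp. $C\setminus\{(b_1,\dots,b_k)\}$), where $C=g(X)$ if $X$ is in the domain of $g$ and $C=\emptyset$ otherwise; from $k\psi$ play goes to $(\mathfrak{B},g,\#',\psi)$; at a jump atom $k$, if the original formula $\varphi$ has some subformula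 of the form $k\chi$, the verifier chooses such a subformula $k\chi$ of $\varphi$ and play continues from $(\mathfrak{B},g,\#',k\chi)$, otherwise the play ends and the falsifier wins. At atoms $R(\bar x)$, $X(\bar x)$, $x=y$ the play ends: if $\#'=+$, $\exists$ wins iff the atom holds in $(\mathfrak{B},g)$ in the usual first-order sense (else $\forall$ wins); if $\#'=-$, $\forall$ wins iff the atom holds (else $\exists$ wins). Plays last at most $\omega$ rounds; an infinite play is won by neither player. A strategy is winning for a player if every play following it ends after finitely many rounds in a win for that player. $\mathfrak{A}\models^+\varphi$ (for a sentence $\varphi$) iff $\exists$ has a winning strategy in $G(\mathfrak{A},\emptyset,+,\varphi)$, and $\mathfrak{A}\models^-\varphi$ iff $\exists$ has a winning strategy in $G(\mathfrak{A},\emptyset,-,\varphi)$, where $\emptyset$ is the empty assignment. *)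

theory Defs
  imports Main "HOL-Library.Sublist"
begin

section \<open>Syntax\<close>

text \<open>A relational vocabulary maps each of its symbols to the arity of the symbol.\<close>

type_synonym 's vocab = "'s \<rightharpoonup> nat"

type_synonym var = nat

datatype relvar = RelVar (rv_arity: nat) (rv_index: nat)

text \<open>
  \<open>Ins\<close> is $I$ and \<open>Del\<close> is $D$; the suffix \<open>Elem\<close>, \<open>Rel\<close> or \<open>Var\<close> says whether the operator
  acts on the domain, on a relation symbol or on a relation variable.  \<open>JumpAt k\<close> is the jump
  atom $k$ and \<open>Label k \<psi>\<close> is $k\psi$.
\<close>

datatype 's form =
    RelAt 's "var list"
  | VarAt relvar "var list"
  | EqAt var var
  | JumpAt nat
  | Neg "'s form"
  | Conj "'s form" "'s form"
  | Exists var "'s form"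
  | InsElem var "'s form"
  | InsRel 's "var list" "'s form"
  | InsVar relvar "var list" "'s form"
  | DelRel 's "var list" "'s form"
  | DelVar relvar "var list" "'s form"
  | Label nat "'s form"

definition ok_relvar :: "relvar \<Rightarrow> var list \<Rightarrow> bool" where
  "ok_relvar X xs \<longleftrightarrow> rv_arity X = length xs \<and> 1 \<le> length xs"

text \<open>Membership in $\mathcal{L}^*(\sigma)$.\<close>

primrec L_star :: "'s vocab \<Rightarrow> 's form \<Rightarrow> bool" where
  "L_star \<sigma> (RelAt R xs) \<longleftrightarrow> \<sigma> R = Some (length xs)"
| "L_star \<sigma> (VarAt X xs) \<longleftrightarrow> ok_relvar X xs"
| "L_star \<sigma> (EqAt x y) \<longleftrightarrow> True"
| "L_star \<sigma> (JumpAt k) \<longleftrightarrow> True"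
| "L_star \<sigma> (Neg \<phi>) \<longleftrightarrow> L_star \<sigma> \<phi>"
| "L_star \<sigma> (Conj \<phi> \<psi>) \<longleftrightarrow> L_star \<sigma> \<phi> \<and> L_star \<sigma> \<psi>"
| "L_star \<sigma> (Exists x \<phi>) \<longleftrightarrow> L_star \<sigma> \<phi>"
| "L_star \<sigma> (InsElem x \<phi>) \<longleftrightarrow> L_star \<sigma> \<phi>"
| "L_star \<sigma> (InsRel R xs \<phi>) \<longleftrightarrow> \<sigma> R = Some (length xs) \<and> L_star \<sigma> \<phi>"
| "L_star \<sigma> (InsVar X xs \<phi>) \<longleftrightarrow> ok_relvar X xs \<and> L_star \<sigma> \<phi>"
| "L_star \<sigma> (DelRel R xs \<phi>) \<longleftrightarrow> \<sigma> R = Some (length xs) \<and> L_star \<sigma> \<phi>"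
| "L_star \<sigma> (DelVar X xs \<phi>) \<longleftrightarrow> ok_relvar X xs \<and> L_star \<sigma> \<phi>"
| "L_star \<sigma> (Label k \<phi>) \<longleftrightarrow> L_star \<sigma> \<phi>"

primrec children :: "'s form \<Rightarrow> 's form list" where
  "children (RelAt R xs) = []"
| "children (VarAt X xs) = []"
| "children (EqAt x y) = []"
| "children (JumpAt k) = []"
| "children (Neg \<phi>) = [\<phi>]"
| "children (Conj \<phi> \<psi>) = [\<phi>, \<psi>]"
| "children (Exists x \<phi>) = [\<phi>]"
| "children (InsElem x \<phi>) = [\<phi>]"
| "children (InsRel R xs \<phi>) = [\<phi>]"
| "children (InsVar X xs \<phi>) = [\<phi>]"
| "children (DelRel R xs \<phi>) = [\<phi>]"
| "children (DelVar X xs \<phi>) = [\<phi>]"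
| "children (Label k \<phi>) = [\<phi>]"

text \<open>
  Occurrences of subformulae are addressed by paths from the root.  The occurrence at path \<open>p\<close>
  is a subformula of the occurrence at path \<open>q\<close> iff \<open>q\<close> is a prefix of \<open>p\<close>.
\<close>

fun subform_at :: "'s form \<Rightarrow> nat list \<Rightarrow> 's form option" where
  "subform_at \<phi> [] = Some \<phi>"
| "subform_at \<phi> (i # p) =
     (if i < length (children \<phi>) then subform_at (children \<phi> ! i) p else None)"

definition nonstandard_jump :: "'s form \<Rightarrow> bool" where
  "nonstandard_jump \<phi> \<longleftrightarrow>
     (\<exists>k p q \<psi>. subform_at \<phi> p = Some (JumpAt k) \<and> subform_at \<phi> q = Some (Label k \<psi>)
        \<and> \<not> prefix q p)"

definition L :: "'s vocab \<Rightarrow> 's form set" where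
  "L \<sigma> = {\<phi>. L_star \<sigma> \<phi> \<and> \<not> nonstandard_jump \<phi>}"

primrec free_vars :: "'s form \<Rightarrow> var set" where
  "free_vars (RelAt R xs) = set xs"
| "free_vars (VarAt X xs) = set xs"
| "free_vars (EqAt x y) = {x, y}"
| "free_vars (JumpAt k) = {}"
| "free_vars (Neg \<phi>) = free_vars \<phi>"
| "free_vars (Conj \<phi> \<psi>) = free_vars \<phi> \<union> free_vars \<psi>"
| "free_vars (Exists x \<phi>) = free_vars \<phi> - {x}"
| "free_vars (InsElem x \<phi>) = free_vars \<phi> - {x}"
| "free_vars (InsRel R xs \<phi>) = free_vars \<phi> - set xs"
| "free_vars (InsVar X xs \<phi>) = free_vars \<phi> - set xs"
| "free_vars (DelRel R xs \<phi>) = free_vars \<phi> - set xs"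
| "free_vars (DelVar X xs \<phi>) = free_vars \<phi> - set xs"
| "free_vars (Label k \<phi>) = free_vars \<phi>"

primrec free_relvars :: "'s form \<Rightarrow> relvar set" where
  "free_relvars (RelAt R xs) = {}"
| "free_relvars (VarAt X xs) = {X}"
| "free_relvars (EqAt x y) = {}"
| "free_relvars (JumpAt k) = {}"
| "free_relvars (Neg \<phi>) = free_relvars \<phi>"
| "free_relvars (Conj \<phi> \<psi>) = free_relvars \<phi> \<union> free_relvars \<psi>"
| "free_relvars (Exists x \<phi>) = free_relvars \<phi>"
| "free_relvars (InsElem x \<phi>) = free_relvars \<phi>"
| "free_relvars (InsRel R xs \<phi>) = free_relvars \<phi>"
| "free_relvars (InsVar X xs \<phi>) = free_relvars \<phi> - {X}"
| "free_relvars (DelRel R xs \<phi>) = free_relvars \<phi>"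
| "free_relvars (DelVar X xs \<phi>) = free_relvars \<phi> - {X}"
| "free_relvars (Label k \<phi>) = free_relvars \<phi>"

definition sentence :: "'s form \<Rightarrow> bool" where
  "sentence \<phi> \<longleftrightarrow> free_vars \<phi> = {} \<and> free_relvars \<phi> = {}"

section \<open>Game semantics\<close>

record ('s, 'd) model =
  universe :: "'d set"
  interp :: "'s \<Rightarrow> 'd list set"

record 'd assignment =
  elem_of :: "var \<rightharpoonup> 'd"
  rel_of :: "relvar \<rightharpoonup> 'd list set"

definition empty_assignment :: "'d assignment" where
  "empty_assignment = \<lparr>elem_of = Map.empty, rel_of = Map.empty\<rparr>"

datatype player = Eloise | Abelard

datatype sign = Plus | Minus

primrec opposite :: "sign \<Rightarrow> sign" where
  "opposite Plus = Minus"
| "opposite Minus = Plus"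

primrec verifier :: "sign \<Rightarrow> player" where
  "verifier Plus = Eloise"
| "verifier Minus = Abelard"

abbreviation falsifier :: "sign \<Rightarrow> player" where
  "falsifier s \<equiv> verifier (opposite s)"

type_synonym ('s, 'd) position = "('s, 'd) model \<times> 'd assignment \<times> sign \<times> 's form"

text \<open>
  The element added by $Ix$ is a fixed but arbitrary one outside the domain.  It exists whenever
  the domain is not the whole type; this is preserved throughout a play that starts from a finite
  domain over an infinite type.
\<close>

definition fresh :: "'d set \<Rightarrow> 'd" where
  "fresh A = (SOME b. b \<notin> A)"

definition tuples :: "'d set \<Rightarrow> nat \<Rightarrow> 'd list set" where
  "tuples A k = {bs. length bs = k \<and> set bs \<subseteq> A}"

definition assign :: "'d assignment \<Rightarrow> var list \<Rightarrow> 'd list \<Rightarrow> 'd assignment" where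
  "assign g xs bs = g\<lparr>elem_of := (elem_of g)(xs [\<mapsto>] bs)\<rparr>"

definition rel_or_empty :: "'d assignment \<Rightarrow> relvar \<Rightarrow> 'd list set" where
  "rel_or_empty g X = (case rel_of g X of Some C \<Rightarrow> C | None \<Rightarrow> {})"

definition assign_rel :: "'d assignment \<Rightarrow> relvar \<Rightarrow> 'd list set \<Rightarrow> 'd assignment" where
  "assign_rel g X C = g\<lparr>rel_of := (rel_of g)(X \<mapsto> C)\<rparr>"

definition set_interp :: "('s, 'd) model \<Rightarrow> 's \<Rightarrow> 'd list set \<Rightarrow> ('s, 'd) model" where
  "set_interp B R C = B\<lparr>interp := (interp B)(R := C)\<rparr>"

definition jump_targets :: "'s form \<Rightarrow> nat \<Rightarrow> 's form set" where
  "jump_targets \<phi> k = {Label k \<chi> | \<chi> p. subform_at \<phi> p = Some (Label k \<chi>)}"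

text \<open>
  The first argument of \<open>moves\<close> is the original formula of the game.  A play ends exactly at the
  positions without moves.  Positions carry a formula rather than an occurrence of one, since
  what may happen from a position depends only on the formula.
\<close>

fun moves :: "'s form \<Rightarrow> ('s, 'd) position \<Rightarrow> ('s, 'd) position set" where
  "moves \<phi> (B, g, s, RelAt R xs) = {}"
| "moves \<phi> (B, g, s, VarAt X xs) = {}"
| "moves \<phi> (B, g, s, EqAt x y) = {}"
| "moves \<phi> (B, g, s, JumpAt k) = {(B, g, s, \<psi>) | \<psi>. \<psi> \<in> jump_targets \<phi> k}"
| "moves \<phi> (B, g, s, Neg \<psi>) = {(B, g, opposite s, \<psi>)}"
| "moves \<phi> (B, g, s, Conj \<psi> \<psi>') = {(B, g, s, \<psi>), (B, g, s, \<psi>')}"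
| "moves \<phi> (B, g, s, Exists x \<psi>) = {(B, assign g [x] [b], s, \<psi>) | b. b \<in> universe B}"
| "moves \<phi> (B, g, s, InsElem x \<psi>) =
     (let b = fresh (universe B)
      in {(B\<lparr>universe := insert b (universe B)\<rparr>, assign g [x] [b], s, \<psi>)})"
| "moves \<phi> (B, g, s, InsRel R xs \<psi>) =
     {(set_interp B R (insert bs (interp B R)), assign g xs bs, s, \<psi>)
      | bs. bs \<in> tuples (universe B) (length xs)}"
| "moves \<phi> (B, g, s, InsVar X xs \<psi>) =
     {(B, assign_rel (assign g xs bs) X (insert bs (rel_or_empty g X)), s, \<psi>)
      | bs. bs \<in> tuples (universe B) (length xs)}"
| "moves \<phi> (B, g, s, DelRel R xs \<psi>) =
     {(set_interp B R (interp B R - {bs}), assign g xs bs, s, \<psi>)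
      | bs. bs \<in> tuples (universe B) (length xs)}"
| "moves \<phi> (B, g, s, DelVar X xs \<psi>) =
     {(B, assign_rel (assign g xs bs) X (rel_or_empty g X - {bs}), s, \<psi>)
      | bs. bs \<in> tuples (universe B) (length xs)}"
| "moves \<phi> (B, g, s, Label k \<psi>) = {(B, g, s, \<psi>)}"

text \<open>
  The player who picks the next position; it is irrelevant at positions with exactly one move.
\<close>

fun mover :: "('s, 'd) position \<Rightarrow> player" where
  "mover (B, g, s, Conj \<psi> \<psi>') = falsifier s"
| "mover (B, g, s, \<psi>) = verifier s"

text \<open>
  The truth of an atom.  If the game starts with an assignment that covers the free variables of
  a formula of \<open>L \<sigma>\<close>, then all variables of an atom reached in a play have a value.
\<close>

fun true_atom :: "('s, 'd) model \<Rightarrow> 'd assignment \<Rightarrow> 's form \<Rightarrow> bool" where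
  "true_atom B g (RelAt R xs) \<longleftrightarrow> map (the \<circ> elem_of g) xs \<in> interp B R"
| "true_atom B g (VarAt X xs) \<longleftrightarrow> map (the \<circ> elem_of g) xs \<in> the (rel_of g X)"
| "true_atom B g (EqAt x y) \<longleftrightarrow> the (elem_of g x) = the (elem_of g y)"
| "true_atom B g _ \<longleftrightarrow> False"

text \<open>
  The winner of a play that ends at the given position, i.e. at a position without moves.  This
  includes jump atoms without a target, which are lost by the verifier.
\<close>

fun winner :: "('s, 'd) position \<Rightarrow> player" where
  "winner (B, g, s, \<psi>) = (if true_atom B g \<psi> then verifier s else falsifier s)"

type_synonym ('s, 'd) strategy = "('s, 'd) position list \<Rightarrow> ('s, 'd) position"

text \<open>
  The nonempty finite initial segments of plays from \<open>u\<^sub>0\<close> in which \<open>P\<close> follows the strategy \<open>S\<close>.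
  A strategy sees the whole history, the current position being the last element.
\<close>

inductive follows ::
  "'s form \<Rightarrow> player \<Rightarrow> ('s, 'd) strategy \<Rightarrow> ('s, 'd) position \<Rightarrow> ('s, 'd) position list \<Rightarrow> bool"
  for \<phi> P S u\<^sub>0 where
  start: "follows \<phi> P S u\<^sub>0 [u\<^sub>0]"
| step: "follows \<phi> P S u\<^sub>0 (h @ [u]) \<Longrightarrow> v \<in> moves \<phi> u \<Longrightarrow> (mover u = P \<Longrightarrow> v = S (h @ [u])) \<Longrightarrow>
    follows \<phi> P S u\<^sub>0 (h @ [u, v])"

text \<open>
  The three conditions: \<open>S\<close> prescribes legal moves, all plays that end are won by \<open>P\<close>, and no
  play is infinite.
\<close>

definition winning_strategy ::
  "'s form \<Rightarrow> player \<Rightarrow> ('s, 'd) position \<Rightarrow> ('s, 'd) strategy \<Rightarrow> bool" where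
  "winning_strategy \<phi> P u\<^sub>0 S \<longleftrightarrow>
     (\<forall>h u. follows \<phi> P S u\<^sub>0 (h @ [u]) \<and> moves \<phi> u \<noteq> {} \<and> mover u = P \<longrightarrow>
        S (h @ [u]) \<in> moves \<phi> u)
   \<and> (\<forall>h u. follows \<phi> P S u\<^sub>0 (h @ [u]) \<and> moves \<phi> u = {} \<longrightarrow> winner u = P)
   \<and> \<not> (\<exists>\<pi> :: nat \<Rightarrow> ('s, 'd) position. \<forall>n. follows \<phi> P S u\<^sub>0 (map \<pi> [0..<Suc n]))"

definition sat_pos :: "('s, 'd) model \<Rightarrow> 's form \<Rightarrow> bool" (infix "\<Turnstile>\<^sup>+" 50) where
  "A \<Turnstile>\<^sup>+ \<phi> \<longleftrightarrow> (\<exists>S. winning_strategy \<phi> Eloise (A, empty_assignment, Plus, \<phi>) S)"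

definition sat_neg :: "('s, 'd) model \<Rightarrow> 's form \<Rightarrow> bool" (infix "\<Turnstile>\<^sup>-" 50) where
  "A \<Turnstile>\<^sup>- \<phi> \<longleftrightarrow> (\<exists>S. winning_strategy \<phi> Eloise (A, empty_assignment, Minus, \<phi>) S)"

section \<open>Word models\<close>

datatype 'a word_symbol = Succ | P 'a

definition word_vocab :: "'a set \<Rightarrow> 'a word_symbol vocab" where
  "word_vocab \<Sigma> R = (case R of Succ \<Rightarrow> Some 2 | P a \<Rightarrow> if a \<in> \<Sigma> then Some 1 else None)"

text \<open>Letters are counted from 1 in the word model and from 0 in lists.\<close>

definition word_model :: "'a list \<Rightarrow> ('a word_symbol, nat) model" where
  "word_model w =
     \<lparr>universe = {0..length w},
      interp = (\<lambda>R. case R of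
          Succ \<Rightarrow> {[i, i + 1] | i. i < length w}
        | P a \<Rightarrow> {[i] | i. 1 \<le> i \<and> i \<le> length w \<and> w ! (i - 1) = a})\<rparr>"

section \<open>Turing machines\<close>

datatype ('a, 'g) tape_symbol = Blank | Inp 'a | Aux 'g

datatype direction = Left | Stay | Right

record ('q, 'a, 'g) tm =
  states :: "'q set"
  aux_symbols :: "'g set"
  initial :: 'q
  accepting :: "'q set"
  delta :: "'q \<times> ('a, 'g) tape_symbol \<rightharpoonup> 'q \<times> ('a, 'g) tape_symbol \<times> direction"

definition tape_alphabet :: "'a set \<Rightarrow> ('q, 'a, 'g) tm \<Rightarrow> ('a, 'g) tape_symbol set" where
  "tape_alphabet \<Sigma> M = insert Blank (Inp ` \<Sigma> \<union> Aux ` aux_symbols M)"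

definition turing_machine :: "'a set \<Rightarrow> ('q, 'a, 'g) tm \<Rightarrow> bool" where
  "turing_machine \<Sigma> M \<longleftrightarrow>
     finite (states M) \<and> finite (aux_symbols M) \<and> initial M \<in> states M \<and> accepting M \<subseteq> states M \<and>
     dom (delta M) \<subseteq> states M \<times> tape_alphabet \<Sigma> M \<and>
     ran (delta M) \<subseteq> states M \<times> tape_alphabet \<Sigma> M \<times> UNIV"

text \<open>
  The tape is infinite in both directions; the input is written on the cells $0, \dots, n-1$ of
  an otherwise blank tape, and the head starts on cell 0.  The machine halts when its transition
  function is undefined, and it then accepts or rejects according to its state.
\<close>

record ('q, 'a, 'g) config =
  state :: 'q
  head :: int
  tape :: "int \<Rightarrow> ('a, 'g) tape_symbol"

primrec offset :: "direction \<Rightarrow> int" where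
  "offset Left = - 1"
| "offset Stay = 0"
| "offset Right = 1"

definition initial_config :: "('q, 'a, 'g) tm \<Rightarrow> 'a list \<Rightarrow> ('q, 'a, 'g) config" where
  "initial_config M w =
     \<lparr>state = initial M, head = 0,
      tape = (\<lambda>i. if 0 \<le> i \<and> i < int (length w) then Inp (w ! nat i) else Blank)\<rparr>"

definition tm_step :: "('q, 'a, 'g) tm \<Rightarrow> ('q, 'a, 'g) config \<Rightarrow> ('q, 'a, 'g) config \<Rightarrow> bool" where
  "tm_step M c c' \<longleftrightarrow>
     (\<exists>q a d. delta M (state c, tape c (head c)) = Some (q, a, d) \<and>
        c' = \<lparr>state = q, head = head c + offset d, tape = (tape c)(head c := a)\<rparr>)"

definition halts_in :: "('q, 'a, 'g) tm \<Rightarrow> 'a list \<Rightarrow> 'q \<Rightarrow> bool" where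
  "halts_in M w q \<longleftrightarrow>
     (\<exists>c. (tm_step M)\<^sup>*\<^sup>* (initial_config M w) c \<and> \<not> (\<exists>c'. tm_step M c c') \<and> state c = q)"

definition tm_accepts :: "('q, 'a, 'g) tm \<Rightarrow> 'a list \<Rightarrow> bool" where
  "tm_accepts M w \<longleftrightarrow> (\<exists>q. halts_in M w q \<and> q \<in> accepting M)"

definition tm_rejects :: "('q, 'a, 'g) tm \<Rightarrow> 'a list \<Rightarrow> bool" where
  "tm_rejects M w \<longleftrightarrow> (\<exists>q. halts_in M w q \<and> q \<notin> accepting M)"

end

theory Submission
  imports Defs
begin

text \<open>
  A single label is put in front of a formula that performs one step of the machine and then jumps
  back.  The tape is a chain of elements under \<open>Succ\<close>, extended by fresh elements at both ends;
  head position and state are held in first-order variables.  Every choice in the formula is pinned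
  down by a first-order condition checked immediately afterwards, so neither player has a real choice:
  play from a position that encodes a configuration leads to one that encodes its successor, with
  unchanged sign, and a halting configuration is decided by whether its state accepts.  A diverging
  computation gives an infinite play, which nobody wins: formally, the winning positions form a
  least fixed point, so that a win yields a halting computation.
\<close>

section \<open>Winning positions\<close>

text \<open>An operator changes the model or the assignment only for what is played below it, so
  every operation of the machine formula takes its continuation \<open>\<psi>\<close> as an
  argument. Its correctness has the form \<open>ev K (op \<psi>) s B g \<longleftrightarrow> ev K
  \<psi> s B' g'\<close>, where \<open>B'\<close> and \<open>g'\<close> do not depend on
  \<open>K\<close>, \<open>\<psi>\<close> or the sign. The analysis of one machine step is therefore
  made once and used with two values of a jump: with winning itself, to build a win backwards along
  a halting computation, and with the predicate that every encoded configuration halts as the sign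
  asks, which is closed under a step and hence contains all wins. The signs need no separate
  treatment: a first-order condition with truth value \<open>c\<close> is worth
  \<open>c \<longleftrightarrow> s = Plus\<close>, and this is all that the pins and the guards use.
  The vocabulary has no names for states or blanks; the prelude creates one fresh element for each
  state and tape symbol, kept in a variable of its own, and equality with that variable replaces a
  constant.\<close>

text \<open>Inductive, so that a win has a well-founded justification and an infinite play never
  counts. The rule \<open>opp\<close> asks for a move because dead ends are decided by
  \<open>winner\<close> alone; otherwise they would be won vacuously.\<close>

inductive wins :: "'s form \<Rightarrow> player \<Rightarrow> ('s, 'd) position \<Rightarrow> bool" for \<phi> p where
  stop: "moves \<phi> u = {} \<Longrightarrow> winner u = p \<Longrightarrow> wins \<phi> p u"
| own: "mover u = p \<Longrightarrow> v \<in> moves \<phi> u \<Longrightarrow> wins \<phi> p v \<Longrightarrow> wins \<phi> p u"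
| opp: "mover u \<noteq> p \<Longrightarrow> moves \<phi> u \<noteq> {} \<Longrightarrow> (\<And>v. v \<in> moves \<phi> u \<Longrightarrow> wins \<phi> p v) \<Longrightarrow> wins \<phi> p u"

lemma follows_hd:
  assumes "follows \<phi> p S u h"
  shows "h \<noteq> [] \<and> hd h = u"
  using assms
proof (induction)
  case (step h u' v)
  then show ?case by (cases h) auto
qed simp

text \<open>Only histories that begin at \<open>u\<close> matter. This makes it possible to replace
  a strategy that sees a prepended position by one written directly for the rest of the
  play.\<close>

lemma follows_cong:
  assumes "\<And>h. h \<noteq> [] \<Longrightarrow> hd h = u \<Longrightarrow> S h = S' h" and "follows \<phi> p S u h"
  shows "follows \<phi> p S' u h"
  using assms(2)
proof (induction)
  case start
  then show ?case by (rule follows.start)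
next
  case (step h u' v)
  have "S (h @ [u']) = S' (h @ [u'])"
    using follows_hd[OF step.hyps(1)] assms(1) by simp
  with step show ?case by (auto intro: follows.step)
qed

text \<open>Histories grow at the end, while winning is analysed from the root. Splitting off the
  first position leaves a history from its successor, under the strategy that remembers
  \<open>u\<close>.\<close>

lemma follows_unfold:
  assumes "follows \<phi> p S u h"
  shows "h = [u] \<or> (\<exists>v r. h = u # v # r \<and> v \<in> moves \<phi> u \<and> (mover u = p \<longrightarrow> v = S [u])
      \<and> follows \<phi> p (\<lambda>h. S (u # h)) v (v # r))"
  using assms
proof (induction)
  case start
  then show ?case by simp
next
  case (step h u' v)
  from step.IH show ?case
  proof
    assume "h @ [u'] = [u]"
    then have "h = []" "u' = u" by auto
    with step.hyps show ?thesis by (auto intro: follows.start)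
  next
    assume "\<exists>v r. h @ [u'] = u # v # r \<and> v \<in> moves \<phi> u \<and> (mover u = p \<longrightarrow> v = S [u])
      \<and> follows \<phi> p (\<lambda>h. S (u # h)) v (v # r)"
    then obtain x r where x: "h @ [u'] = u # x # r" "x \<in> moves \<phi> u" "mover u = p \<longrightarrow> x = S [u]"
      "follows \<phi> p (\<lambda>h. S (u # h)) x (x # r)" by blast
    then obtain h' where h': "h = u # h'" "h' @ [u'] = x # r" by (cases h) auto
    have "follows \<phi> p (\<lambda>h. S (u # h)) x (h' @ [u', v])"
      using step.hyps x(4) h' by (intro follows.step) auto
    moreover have "h' @ [u', v] = x # r @ [v]" using h'(2)
      by (metis append_Cons append_assoc append_Nil)
    ultimately have "h @ [u', v] = u # x # r @ [v]" "follows \<phi> p (\<lambda>h. S (u # h)) x (x # r @ [v])"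
      using h' by simp_all
    then show ?thesis using x(2,3) by blast
  qed
qed

lemma winning_strategyD:
  assumes "winning_strategy \<phi> p u S"
  shows "follows \<phi> p S u (h @ [x]) \<Longrightarrow> moves \<phi> x \<noteq> {} \<Longrightarrow> mover x = p \<Longrightarrow> S (h @ [x]) \<in> moves \<phi> x"
    and "follows \<phi> p S u (h @ [x]) \<Longrightarrow> moves \<phi> x = {} \<Longrightarrow> winner x = p"
    and "\<exists>n. \<not> follows \<phi> p S u (map \<pi> [0..<Suc n])"
  using assms unfolding winning_strategy_def by blast+

text \<open>The combined strategy reads off the second position of the history which successor was
  reached and hands over to its strategy. If \<open>p\<close> is to move at \<open>u\<close>, only
  \<open>v0\<close> can be reached, so only there is a strategy demanded. This covers all three
  rules of \<open>wins\<close>.\<close>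

lemma winning_strategy_compose:
  assumes stop: "moves \<phi> u = {} \<Longrightarrow> winner u = p"
    and v0: "mover u = p \<Longrightarrow> moves \<phi> u \<noteq> {} \<Longrightarrow> v0 \<in> moves \<phi> u"
    and T: "\<And>v. v \<in> moves \<phi> u \<Longrightarrow> (mover u = p \<Longrightarrow> v = v0) \<Longrightarrow> winning_strategy \<phi> p v (T v)"
  shows "winning_strategy \<phi> p u (\<lambda>h. if tl h = [] then v0 else T (hd (tl h)) (tl h))"
    (is "winning_strategy \<phi> p u ?S")
proof -
  have unf: "h = [u] \<or> (\<exists>v r. h = u # v # r \<and> winning_strategy \<phi> p v (T v) \<and> follows \<phi> p (T v) v (v # r))"
    if fo: "follows \<phi> p ?S u h" for h
  proof (cases "h = [u]")
    case False
    then obtain v r where v: "h = u # v # r" "v \<in> moves \<phi> u" "mover u = p \<longrightarrow> v = ?S [u]"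
      "follows \<phi> p (\<lambda>h. ?S (u # h)) v (v # r)" using follows_unfold[OF fo] by blast
    have "follows \<phi> p (T v) v (v # r)"
      by (rule follows_cong[OF _ v(4)]) simp
    moreover have "winning_strategy \<phi> p v (T v)" using v(2,3) by (intro T) simp_all
    ultimately show ?thesis using v by blast
  qed simp
  show ?thesis unfolding winning_strategy_def
  proof (intro conjI allI impI notI)
    fix h x assume A: "follows \<phi> p ?S u (h @ [x]) \<and> moves \<phi> x \<noteq> {} \<and> mover x = p"
    show "?S (h @ [x]) \<in> moves \<phi> x"
    proof (cases "h @ [x] = [u]")
      case True
      then show ?thesis using A v0 by simp
    next
      case False
      then obtain v r where v: "h @ [x] = u # v # r" "winning_strategy \<phi> p v (T v)"
        "follows \<phi> p (T v) v (v # r)" using unf A by blast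
      then obtain h' where h': "h = u # h'" "v # r = h' @ [x]" by (cases h) auto
      then have "T v (h' @ [x]) \<in> moves \<phi> x"
        using winning_strategyD(1)[OF v(2), of h' x] v(3) A by simp
      moreover have "hd (h' @ [x]) = v" using h'(2) by (metis list.sel(1))
      ultimately show ?thesis using h' by simp
    qed
  next
    fix h x assume A: "follows \<phi> p ?S u (h @ [x]) \<and> moves \<phi> x = {}"
    show "winner x = p"
    proof (cases "h @ [x] = [u]")
      case True
      then show ?thesis using A stop by simp
    next
      case False
      then obtain v r where v: "h @ [x] = u # v # r" "winning_strategy \<phi> p v (T v)"
        "follows \<phi> p (T v) v (v # r)" using unf A by blast
      then obtain h' where h': "h = u # h'" "v # r = h' @ [x]" by (cases h) auto
      then show ?thesis using winning_strategyD(2)[OF v(2), of h' x] v(3) A by simp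
    qed
  next
    assume "\<exists>\<pi>. \<forall>n. follows \<phi> p ?S u (map \<pi> [0..<Suc n])"
    then obtain \<pi> where \<pi>: "\<And>n. follows \<phi> p ?S u (map \<pi> [0..<Suc n])" by blast
    have eq: "map \<pi> [0..<Suc (Suc n)] = \<pi> 0 # map (\<pi> \<circ> Suc) [0..<Suc n]" for n
      by (subst upt_conv_Cons) (simp_all add: map_Suc_upt[symmetric] del: upt_Suc)
    \<comment> \<open>Without its first position an infinite play from \<open>u\<close> is an
      infinite play from \<open>\<pi> 1\<close> that follows \<open>T (\<pi> 1)\<close>.\<close>
    have *: "winning_strategy \<phi> p (\<pi> 1) (T (\<pi> 1)) \<and>
        follows \<phi> p (T (\<pi> 1)) (\<pi> 1) (map (\<pi> \<circ> Suc) [0..<Suc n])" for n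
    proof -
      have "map (\<pi> \<circ> Suc) [0..<Suc n] = \<pi> 1 # map (\<pi> \<circ> Suc) [Suc 0..<Suc n]"
        by (subst upt_conv_Cons) (simp_all del: upt_Suc)
      then show ?thesis using unf[OF \<pi>[of "Suc n"]] unfolding eq by (simp del: upt_Suc)
    qed
    then show False using winning_strategyD(3)[of \<phi> p "\<pi> 1" "T (\<pi> 1)" "\<pi> \<circ> Suc"] by blast
  qed
qed

lemma wins_imp_strategy:
  assumes "wins \<phi> p u"
  shows "\<exists>S. winning_strategy \<phi> p u S"
  using assms
proof (induction)
  case (stop u)
  show ?case by (rule exI, rule winning_strategy_compose) (use stop in simp_all)
next
  case (own u v)
  then obtain S where S: "winning_strategy \<phi> p v S" by blast
  show ?case
    by (rule exI, rule winning_strategy_compose[where T = "\<lambda>_. S" and ?v0.0 = v])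
      (use own S in simp_all)
next
  case (opp u)
  then obtain T where T: "\<And>v. v \<in> moves \<phi> u \<Longrightarrow> winning_strategy \<phi> p v (T v)" by metis
  show ?case
    by (rule exI, rule winning_strategy_compose[where T = T]) (use opp T in simp_all)
qed

text \<open>If \<open>u\<close> were not winning, dependent choice would build an infinite play
  through non-winning positions that follows \<open>S\<close>.\<close>

lemma strategy_imp_wins:
  assumes S: "winning_strategy \<phi> p u S"
  shows "wins \<phi> p u"
proof (rule ccontr)
  assume nw: "\<not> wins \<phi> p u"
  define Q where "Q n l \<longleftrightarrow> follows \<phi> p S u l \<and> \<not> wins \<phi> p (last l) \<and> length l = Suc n" for n l
  have "\<exists>f. \<forall>n. Q n (f n) \<and> (\<exists>v. f (Suc n) = f n @ [v])"
  proof (rule dependent_nat_choice)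
    show "\<exists>l. Q 0 l" using nw by (intro exI[of _ "[u]"]) (auto simp: Q_def intro: follows.start)
  next
    fix l n assume "Q n l"
    then obtain h x where l: "l = h @ [x]" and f: "follows \<phi> p S u (h @ [x])" and x: "\<not> wins \<phi> p x"
      and len: "length h = n" unfolding Q_def by (cases l rule: rev_cases) auto
    have ne: "moves \<phi> x \<noteq> {}" using S f x unfolding winning_strategy_def by (metis wins.stop)
    \<comment> \<open>If \<open>p\<close> is to move, the move of \<open>S\<close> serves, since a
      winning successor would make \<open>x\<close> winning by \<open>own\<close>. Otherwise
      \<open>opp\<close> provides a successor that is not winning.\<close>
    have "\<exists>v\<in>moves \<phi> x. \<not> wins \<phi> p v \<and> (mover x = p \<longrightarrow> v = S (h @ [x]))"
    proof (cases "mover x = p")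
      case True
      then have "S (h @ [x]) \<in> moves \<phi> x" using S f ne unfolding winning_strategy_def by blast
      then show ?thesis using True x by (auto intro: wins.own)
    next
      case False
      then show ?thesis using x ne wins.opp by blast
    qed
    then obtain v where v: "v \<in> moves \<phi> x" "\<not> wins \<phi> p v" "mover x = p \<longrightarrow> v = S (h @ [x])" by blast
    have "follows \<phi> p S u (h @ [x, v])" using f v by (intro follows.step) auto
    then show "\<exists>l'. Q (Suc n) l' \<and> (\<exists>v. l' = l @ [v])"
      using v(2) len by (intro exI[of _ "h @ [x, v]"] conjI exI[of _ v]) (simp_all add: Q_def l)
  qed
  then obtain f where f: "\<And>n. Q n (f n)" "\<And>n. \<exists>v. f (Suc n) = f n @ [v]" by blast
  \<comment> \<open>Each chosen history extends the previous one by one position, so the last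
    positions form a single play.\<close>
  have "map (\<lambda>n. last (f n)) [0..<Suc n] = f n" for n
  proof (induction n)
    case 0
    have "length (f 0) = 1" using f(1)[of 0] by (simp add: Q_def)
    then show ?case by (cases "f 0") auto
  next
    case (Suc n)
    then show ?case using f(2)[of n] by auto
  qed
  then have "\<forall>n. follows \<phi> p S u (map (\<lambda>n. last (f n)) [0..<Suc n])"
    using f(1) unfolding Q_def by simp
  then show False using S unfolding winning_strategy_def by blast
qed

theorem wins_iff: "wins \<phi> p u \<longleftrightarrow> (\<exists>S. winning_strategy \<phi> p u S)"
  using wins_imp_strategy strategy_imp_wins by blast

section \<open>Evaluation up to the next jump\<close>

text \<open>The value for Eloise of a choice made by the verifier. An empty \<open>A\<close> is
  treated as in the game: the verifier loses, so the value is false for \<open>Plus\<close> and true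
  for \<open>Minus\<close>.\<close>

definition picks :: "sign \<Rightarrow> 'x set \<Rightarrow> ('x \<Rightarrow> bool) \<Rightarrow> bool" where
  "picks s A Q = (if s = Plus then (\<exists>a\<in>A. Q a) else (\<forall>a\<in>A. Q a))"

text \<open>The value of a formula when a jump to the label 0 is given the value \<open>K\<close>.  Winning is the
  least fixed point of \<open>K \<mapsto> ev K (Label 0 \<beta>)\<close>, by \<open>wins_imp_ev\<close> and \<open>ev_imp_wins\<close> below.\<close>

primrec ev :: "(sign \<Rightarrow> ('s, 'd) model \<Rightarrow> 'd assignment \<Rightarrow> bool) \<Rightarrow> 's form \<Rightarrow>
    sign \<Rightarrow> ('s, 'd) model \<Rightarrow> 'd assignment \<Rightarrow> bool" where
  "ev K (RelAt R xs) s B g \<longleftrightarrow> (true_atom B g (RelAt R xs) \<longleftrightarrow> s = Plus)"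
| "ev K (VarAt X xs) s B g \<longleftrightarrow> (true_atom B g (VarAt X xs :: 's form) \<longleftrightarrow> s = Plus)"
| "ev K (EqAt x y) s B g \<longleftrightarrow> (true_atom B g (EqAt x y :: 's form) \<longleftrightarrow> s = Plus)"
| "ev K (JumpAt k) s B g \<longleftrightarrow> (if k = 0 then K s B g else s = Minus)"
| "ev K (Neg \<psi>) s B g \<longleftrightarrow> ev K \<psi> (opposite s) B g"
| "ev K (Conj \<psi> \<psi>') s B g \<longleftrightarrow>
     (if s = Plus then ev K \<psi> s B g \<and> ev K \<psi>' s B g else ev K \<psi> s B g \<or> ev K \<psi>' s B g)"
| "ev K (Exists x \<psi>) s B g \<longleftrightarrow> picks s (universe B) (\<lambda>b. ev K \<psi> s B (assign g [x] [b]))"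
| "ev K (InsElem x \<psi>) s B g \<longleftrightarrow> ev K \<psi> s (B\<lparr>universe := insert (fresh (universe B)) (universe B)\<rparr>)
     (assign g [x] [fresh (universe B)])"
| "ev K (InsRel R xs \<psi>) s B g \<longleftrightarrow> picks s (tuples (universe B) (length xs))
     (\<lambda>bs. ev K \<psi> s (set_interp B R (insert bs (interp B R))) (assign g xs bs))"
| "ev K (InsVar X xs \<psi>) s B g \<longleftrightarrow> picks s (tuples (universe B) (length xs))
     (\<lambda>bs. ev K \<psi> s B (assign_rel (assign g xs bs) X (insert bs (rel_or_empty g X))))"
| "ev K (DelRel R xs \<psi>) s B g \<longleftrightarrow> picks s (tuples (universe B) (length xs))
     (\<lambda>bs. ev K \<psi> s (set_interp B R (interp B R - {bs})) (assign g xs bs))"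
| "ev K (DelVar X xs \<psi>) s B g \<longleftrightarrow> picks s (tuples (universe B) (length xs))
     (\<lambda>bs. ev K \<psi> s B (assign_rel (assign g xs bs) X (rel_or_empty g X - {bs})))"
| "ev K (Label k \<psi>) s B g \<longleftrightarrow> ev K \<psi> s B g"

lemma wins_unfold:
  "wins \<phi> p u \<longleftrightarrow> (if moves \<phi> u = {} then winner u = p
     else if mover u = p then \<exists>v\<in>moves \<phi> u. wins \<phi> p v else \<forall>v\<in>moves \<phi> u. wins \<phi> p v)"
proof
  assume "wins \<phi> p u"
  then show "if moves \<phi> u = {} then winner u = p
     else if mover u = p then \<exists>v\<in>moves \<phi> u. wins \<phi> p v else \<forall>v\<in>moves \<phi> u. wins \<phi> p v"
    by cases auto
next
  assume *: "if moves \<phi> u = {} then winner u = p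
     else if mover u = p then \<exists>v\<in>moves \<phi> u. wins \<phi> p v else \<forall>v\<in>moves \<phi> u. wins \<phi> p v"
  consider "moves \<phi> u = {}" "winner u = p" | v where "mover u = p" "v \<in> moves \<phi> u" "wins \<phi> p v"
    | "mover u \<noteq> p" "moves \<phi> u \<noteq> {}" "\<forall>v\<in>moves \<phi> u. wins \<phi> p v"
    using * by (simp split: if_splits) blast+
  then show "wins \<phi> p u"
    by cases (blast intro: wins.stop wins.own wins.opp)+
qed

definition ev_pos :: "(sign \<Rightarrow> ('s, 'd) model \<Rightarrow> 'd assignment \<Rightarrow> bool) \<Rightarrow> ('s, 'd) position \<Rightarrow> bool" where
  "ev_pos K u = (case u of (B, g, s, \<psi>) \<Rightarrow> ev K \<psi> s B g)"

text \<open>Jump atoms are excluded because their value comes from \<open>K\<close> or a default and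
  not from their moves.\<close>

lemma ev_unfold:
  assumes "\<nexists>k. \<psi> = JumpAt k"
  shows "ev K \<psi> s B g \<longleftrightarrow> (if moves \<phi> (B, g, s, \<psi>) = {} then winner (B, g, s, \<psi>) = Eloise
     else if mover (B, g, s, \<psi>) = Eloise then \<exists>v\<in>moves \<phi> (B, g, s, \<psi>). ev_pos K v
     else \<forall>v\<in>moves \<phi> (B, g, s, \<psi>). ev_pos K v)"
  using assms by (cases s; cases \<psi>; simp add: ev_pos_def picks_def Let_def Setcompr_eq_image)

text \<open>Induction on \<open>wins\<close>. Away from jumps \<open>ev\<close> obeys the rules of
  the game; at a jump to 0 the target already has its value, which \<open>pre\<close> turns into
  \<open>K\<close>.\<close>

lemma wins_imp_ev:
  assumes targets: "\<And>k. jump_targets \<phi> k = (if k = 0 then {Label 0 \<beta>} else {})"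
    and pre: "\<And>s B g. ev K (Label 0 \<beta>) s B g \<Longrightarrow> K s B g"
    and "wins \<phi> Eloise u"
  shows "ev_pos K u"
proof -
  have *: "ev_pos K u" if "if moves \<phi> u = {} then winner u = Eloise
     else if mover u = Eloise then \<exists>v\<in>moves \<phi> u. ev_pos K v else \<forall>v\<in>moves \<phi> u. ev_pos K v" for u
  proof -
    obtain B g s \<psi> where u: "u = (B, g, s, \<psi>)" by (cases u)
    show ?thesis
    proof (cases "\<exists>k. \<psi> = JumpAt k")
      case True
      then obtain k where k: "\<psi> = JumpAt k" by blast
      have "(k = 0 \<longrightarrow> ev K (Label 0 \<beta>) s B g) \<and> (k \<noteq> 0 \<longrightarrow> s = Minus)"
        using that unfolding u k by (cases s) (auto simp: targets ev_pos_def split: if_splits)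
      then show ?thesis using pre[of s B g] by (simp add: u k ev_pos_def)
    next
      case False
      then show ?thesis using that ev_unfold[OF False, of K s B g \<phi>] unfolding u by (simp only: ev_pos_def prod.case)
    qed
  qed
  from assms(3) show ?thesis
  proof induction
    case (stop u)
    then show ?case by (intro *) simp
  next
    case (own u v)
    then have "moves \<phi> u \<noteq> {}" "\<exists>v\<in>moves \<phi> u. ev_pos K v" by blast+
    then show ?case using own by (intro *) simp
  next
    case (opp u)
    then show ?case by (intro *) simp
  qed
qed

text \<open>With winning as the value of a jump, structural induction suffices: play is followed
  only up to the next jump, where the win is given.\<close>

lemma ev_imp_wins:
  assumes targets: "\<And>k. jump_targets \<phi> k = (if k = 0 then {Label 0 \<beta>} else {})"
    and "ev (\<lambda>s B g. wins \<phi> Eloise (B, g, s, Label 0 \<beta>)) \<psi> s B g"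
  shows "wins \<phi> Eloise (B, g, s, \<psi>)"
  using assms(2)
proof (induction \<psi> arbitrary: s B g)
  case (JumpAt k)
  then show ?case by (subst wins_unfold) (cases s; cases "k = 0"; simp add: targets)
next
  case (Neg \<psi>)
  then show ?case by (subst wins_unfold) simp
next
  case (Conj \<psi> \<psi>')
  then show ?case by (subst wins_unfold) (cases s; simp; blast)
next
  case (InsElem x \<psi>)
  then show ?case by (subst wins_unfold) (simp add: Let_def)
next
  case (Label k \<psi>)
  then show ?case by (subst wins_unfold) simp
next
  case (RelAt R xs)
  then show ?case by (subst wins_unfold) (cases s; auto simp: picks_def Setcompr_eq_image)
next
  case (VarAt X xs)
  then show ?case by (subst wins_unfold) (cases s; auto simp: picks_def Setcompr_eq_image)
next
  case (EqAt x y)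
  then show ?case by (subst wins_unfold) (cases s; auto simp: picks_def Setcompr_eq_image)
next
  case (Exists x \<psi>)
  then show ?case by (subst wins_unfold) (cases s; auto simp: picks_def Setcompr_eq_image)
next
  case (InsRel R xs \<psi>)
  then show ?case by (subst wins_unfold) (cases s; auto simp: picks_def Setcompr_eq_image)
next
  case (InsVar X xs \<psi>)
  then show ?case by (subst wins_unfold) (cases s; auto simp: picks_def Setcompr_eq_image)
next
  case (DelRel R xs \<psi>)
  then show ?case by (subst wins_unfold) (cases s; auto simp: picks_def Setcompr_eq_image)
next
  case (DelVar X xs \<psi>)
  then show ?case by (subst wins_unfold) (cases s; auto simp: picks_def Setcompr_eq_image)
qed

section \<open>Pinned choices\<close>

text \<open>A player who has to choose an element that a first-order condition determines loses unless
  she picks that element, so the choice is forced for both signs.\<close>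

lemma picks_pinned:
  assumes "b\<^sub>0 \<in> A"
    and "\<And>b. b \<in> A \<Longrightarrow> ev K \<theta> s (F b) (G b) \<longleftrightarrow> (b = b\<^sub>0 \<longleftrightarrow> s = Plus)"
  shows "picks s A (\<lambda>b. ev K (Conj \<theta> \<psi>) s (F b) (G b)) \<longleftrightarrow> ev K \<psi> s (F b\<^sub>0) (G b\<^sub>0)"
  using assms by (cases s) (auto simp: picks_def)

lemma ev_Exists_pinned:
  assumes "b\<^sub>0 \<in> universe B"
    and "\<And>b. b \<in> universe B \<Longrightarrow>
      ev K \<theta> s B (assign g [x] [b]) \<longleftrightarrow> (b = b\<^sub>0 \<longleftrightarrow> s = Plus)"
  shows "ev K (Exists x (Conj \<theta> \<psi>)) s B g \<longleftrightarrow> ev K \<psi> s B (assign g [x] [b\<^sub>0])"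
  unfolding ev.simps(7) by (rule picks_pinned[where F = "\<lambda>_. B"]) (use assms in auto)

section \<open>Pinned tuples and register assignment\<close>

definition same1 :: "var \<Rightarrow> var \<Rightarrow> 's form" where
  "same1 u x = EqAt u x"

definition same2 :: "var \<Rightarrow> var \<Rightarrow> var \<Rightarrow> var \<Rightarrow> 's form" where
  "same2 u u' x y = Conj (EqAt u x) (EqAt u' y)"

lemma ev_same1:
  assumes "bs \<in> tuples U (length [u])" and "elem_of g x = Some a" and "x \<noteq> u"
    and "elem_of g' = (elem_of g)([u] [\<mapsto>] bs)"
  shows "ev K (same1 u x) s B g' \<longleftrightarrow> (bs = [a] \<longleftrightarrow> s = Plus)"
proof -
  obtain b where "bs = [b]" using assms(1) by (auto simp: tuples_def length_Suc_conv)
  then show ?thesis using assms by (auto simp: same1_def)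
qed

text \<open>Stated for any \<open>g'\<close> with the right element values, since insertion into and
  deletion from a relation variable also change \<open>rel_of\<close>.\<close>

lemma ev_same2:
  assumes "bs \<in> tuples U (length [u, u'])"
    and "elem_of g x = Some a" and "elem_of g y = Some b" and "{x, y} \<inter> {u, u'} = {}" and "u \<noteq> u'"
    and "elem_of g' = (elem_of g)([u, u'] [\<mapsto>] bs)"
  shows "ev K (same2 u u' x y) s B g' \<longleftrightarrow> (bs = [a, b] \<longleftrightarrow> s = Plus)"
proof -
  obtain c d where "bs = [c, d]" using assms(1) by (auto simp: tuples_def length_Suc_conv)
  then show ?thesis using assms by (cases s) (auto simp: same2_def)
qed

lemma elem_of_assign [simp]: "elem_of (assign g xs bs) = (elem_of g)(xs [\<mapsto>] bs)"
  and rel_of_assign [simp]: "rel_of (assign g xs bs) = rel_of g"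
  and elem_of_assign_rel [simp]: "elem_of (assign_rel g X C) = elem_of g"
  and rel_of_assign_rel [simp]: "rel_of (assign_rel g X C) = (rel_of g)(X \<mapsto> C)"
  and universe_set_interp [simp]: "universe (set_interp B R D) = universe B"
  and interp_set_interp [simp]: "interp (set_interp B R D) = (interp B)(R := D)"
  by (simp_all add: assign_def assign_rel_def set_interp_def)

lemma ev_InsRel1:
  assumes "elem_of g x = Some a" "a \<in> universe B" "x \<noteq> u"
  shows "ev K (InsRel R [u] (Conj (same1 u x) \<psi>)) s B g \<longleftrightarrow>
    ev K \<psi> s (set_interp B R (insert [a] (interp B R))) (assign g [u] [a])"
  unfolding ev.simps(9)
  by (rule picks_pinned, use assms in \<open>simp add: tuples_def\<close>)
    (rule ev_same1, assumption, use assms in simp_all)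

lemma ev_DelRel1:
  assumes "elem_of g x = Some a" "a \<in> universe B" "x \<noteq> u"
  shows "ev K (DelRel R [u] (Conj (same1 u x) \<psi>)) s B g \<longleftrightarrow>
    ev K \<psi> s (set_interp B R (interp B R - {[a]})) (assign g [u] [a])"
  unfolding ev.simps(11)
  by (rule picks_pinned, use assms in \<open>simp add: tuples_def\<close>)
    (rule ev_same1, assumption, use assms in simp_all)

lemma ev_InsRel2:
  assumes "elem_of g x = Some a" "elem_of g y = Some b" "a \<in> universe B" "b \<in> universe B"
    "{x, y} \<inter> {u, u'} = {}" "u \<noteq> u'"
  shows "ev K (InsRel R [u, u'] (Conj (same2 u u' x y) \<psi>)) s B g \<longleftrightarrow>
    ev K \<psi> s (set_interp B R (insert [a, b] (interp B R))) (assign g [u, u'] [a, b])"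
  unfolding ev.simps(9)
  by (rule picks_pinned, use assms in \<open>simp add: tuples_def\<close>)
    (rule ev_same2, assumption, use assms in simp_all)

lemma ev_InsVar2:
  assumes "elem_of g x = Some a" "elem_of g y = Some b" "a \<in> universe B" "b \<in> universe B"
    "{x, y} \<inter> {u, u'} = {}" "u \<noteq> u'"
  shows "ev K (InsVar X [u, u'] (Conj (same2 u u' x y) \<psi>)) s B g \<longleftrightarrow>
    ev K \<psi> s B (assign_rel (assign g [u, u'] [a, b]) X (insert [a, b] (rel_or_empty g X)))"
  unfolding ev.simps(10)
  by (rule picks_pinned[where F = "\<lambda>_. B"], use assms in \<open>simp add: tuples_def\<close>)
    (rule ev_same2, assumption, use assms in simp_all)

lemma ev_DelVar2:
  assumes "elem_of g x = Some a" "elem_of g y = Some b" "a \<in> universe B" "b \<in> universe B"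
    "{x, y} \<inter> {u, u'} = {}" "u \<noteq> u'"
  shows "ev K (DelVar X [u, u'] (Conj (same2 u u' x y) \<psi>)) s B g \<longleftrightarrow>
    ev K \<psi> s B (assign_rel (assign g [u, u'] [a, b]) X (rel_or_empty g X - {[a, b]}))"
  unfolding ev.simps(12)
  by (rule picks_pinned[where F = "\<lambda>_. B"], use assms in \<open>simp add: tuples_def\<close>)
    (rule ev_same2, assumption, use assms in simp_all)

text \<open>Register assignment of \<open>y\<close> to \<open>x\<close>. The quantifier rebinds
  \<open>x\<close> before the comparison, hence \<open>x \<noteq> y\<close>.\<close>

lemma ev_Exists_EqAt:
  assumes "elem_of g y = Some b" "b \<in> universe B" "x \<noteq> y"
  shows "ev K (Exists x (Conj (EqAt x y) \<psi>)) s B g \<longleftrightarrow> ev K \<psi> s B (assign g [x] [b])"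
  by (rule ev_Exists_pinned) (use assms in auto)

definition cond :: "'s form \<Rightarrow> 's form \<Rightarrow> 's form" where
  "cond \<theta> \<psi> = Neg (Conj \<theta> (Neg \<psi>))"

lemma ev_cond:
  assumes "\<And>s. ev K \<theta> s B g \<longleftrightarrow> (c \<longleftrightarrow> s = Plus)"
  shows "ev K (cond \<theta> \<psi>) s B g \<longleftrightarrow> (if c then ev K \<psi> s B g else s = Plus)"
  using assms by (cases s) (auto simp: cond_def)

text \<open>An implication with a false guard is worth \<open>s = Plus\<close>, which is neutral for
  a conjunction under either sign: true in the conjunction at \<open>Plus\<close>, false in the
  disjunction at \<open>Minus\<close>. Only the branch of \<open>k\<^sub>0\<close> remains.\<close>

lemma ev_dispatch:
  assumes "\<And>k s. k \<in> set ks \<Longrightarrow> ev K (\<theta> k) s B g \<longleftrightarrow> (k = k\<^sub>0 \<longleftrightarrow> s = Plus)"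
    and "\<And>s. ev K \<tau> s B g \<longleftrightarrow> s = Plus"
  shows "ev K (foldr Conj (map (\<lambda>k. cond (\<theta> k) (\<psi> k)) ks) \<tau>) s B g \<longleftrightarrow>
    (if k\<^sub>0 \<in> set ks then ev K (\<psi> k\<^sub>0) s B g else s = Plus)"
  using assms(1)
proof (induction ks)
  case Nil
  then show ?case using assms(2) by simp
next
  case (Cons k ks)
  have "ev K (cond (\<theta> k) (\<psi> k)) s B g \<longleftrightarrow> (if k = k\<^sub>0 then ev K (\<psi> k) s B g else s = Plus)"
    by (rule ev_cond) (simp add: Cons.prems)
  then show ?case using Cons by (cases s) auto
qed

section \<open>Standard jumps\<close>

text \<open>\<open>plain {0}\<close> describes what stands below the label, \<open>plain {}\<close>
  what stands beside the path to it.\<close>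

primrec plain :: "nat set \<Rightarrow> 's form \<Rightarrow> bool" where
  "plain J (RelAt R xs) \<longleftrightarrow> True"
| "plain J (VarAt X xs) \<longleftrightarrow> True"
| "plain J (EqAt x y) \<longleftrightarrow> True"
| "plain J (JumpAt k) \<longleftrightarrow> k \<in> J"
| "plain J (Neg \<phi>) \<longleftrightarrow> plain J \<phi>"
| "plain J (Conj \<phi> \<psi>) \<longleftrightarrow> plain J \<phi> \<and> plain J \<psi>"
| "plain J (Exists x \<phi>) \<longleftrightarrow> plain J \<phi>"
| "plain J (InsElem x \<phi>) \<longleftrightarrow> plain J \<phi>"
| "plain J (InsRel R xs \<phi>) \<longleftrightarrow> plain J \<phi>"
| "plain J (InsVar X xs \<phi>) \<longleftrightarrow> plain J \<phi>"
| "plain J (DelRel R xs \<phi>) \<longleftrightarrow> plain J \<phi>"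
| "plain J (DelVar X xs \<phi>) \<longleftrightarrow> plain J \<phi>"
| "plain J (Label k \<phi>) \<longleftrightarrow> False"

lemma plain_children: "plain J \<phi> \<Longrightarrow> \<chi> \<in> set (children \<phi>) \<Longrightarrow> plain J \<chi>"
  by (cases \<phi>) auto

lemma plain_subform: "plain J \<phi> \<Longrightarrow> subform_at \<phi> p = Some \<chi> \<Longrightarrow> plain J \<chi>"
proof (induction p arbitrary: \<phi>)
  case (Cons i p)
  then show ?case using plain_children[OF Cons.prems(1), of "children \<phi> ! i"]
    by (auto split: if_splits)
qed simp

text \<open>An invariant that yields two facts at once: no jump is non-standard, and a jump to 0 has
  a unique target. It speaks of paths because distinct occurrences count separately.\<close>

definition has_entry :: "'s form \<Rightarrow> 's form \<Rightarrow> bool" where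
  "has_entry \<phi> \<beta> \<longleftrightarrow> (\<exists>q. subform_at \<phi> q = Some (Label 0 \<beta>) \<and>
     (\<forall>p k. subform_at \<phi> p = Some (JumpAt k) \<longrightarrow> k = 0 \<and> prefix q p) \<and>
     (\<forall>p k \<psi>. subform_at \<phi> p = Some (Label k \<psi>) \<longrightarrow> p = q))"

lemma has_entry_Label:
  assumes "plain {0} \<beta>"
  shows "has_entry (Label 0 \<beta>) \<beta>"
  unfolding has_entry_def
proof (intro exI[of _ "[]"] conjI allI impI)
  fix p k assume "subform_at (Label 0 \<beta>) p = Some (JumpAt k)"
  then obtain p' where "subform_at \<beta> p' = Some (JumpAt k)" by (cases p) (auto split: if_splits)
  from plain_subform[OF assms this] show "k = 0" by simp
next
  fix p k \<psi> assume l: "subform_at (Label 0 \<beta>) p = Some (Label k \<psi>)"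
  show "p = []"
  proof (cases p)
    case (Cons i p')
    then have "subform_at \<beta> p' = Some (Label k \<psi>)" using l by (auto split: if_splits)
    from plain_subform[OF assms this] show ?thesis by simp
  qed
qed simp_all

lemma has_entry_child:
  assumes entry: "has_entry \<psi> \<beta>" and i: "i < length (children \<phi>)" "children \<phi> ! i = \<psi>"
    and others: "\<And>j. j < length (children \<phi>) \<Longrightarrow> j \<noteq> i \<Longrightarrow> plain {} (children \<phi> ! j)"
    and \<phi>: "\<And>k \<chi>. \<phi> \<noteq> Label k \<chi>" "\<And>k. \<phi> \<noteq> JumpAt k"
  shows "has_entry \<phi> \<beta>"
proof -
  obtain q where q: "subform_at \<psi> q = Some (Label 0 \<beta>)"
    "\<And>p k. subform_at \<psi> p = Some (JumpAt k) \<Longrightarrow> k = 0 \<and> prefix q p"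
    "\<And>p k \<chi>. subform_at \<psi> p = Some (Label k \<chi>) \<Longrightarrow> p = q"
    using entry unfolding has_entry_def by blast
  \<comment> \<open>A proper subformula that is a jump atom or a label is not
    \<open>plain {}\<close>, so it cannot lie in a sibling and its path runs through child
    \<open>i\<close>.\<close>
  have sub: "\<exists>p'. p = i # p' \<and> subform_at \<psi> p' = Some \<chi>"
    if p: "subform_at \<phi> p = Some \<chi>" and \<chi>: "\<not> plain {} \<chi>" "\<chi> \<noteq> \<phi>" for p \<chi>
  proof (cases p)
    case Nil
    then show ?thesis using p \<chi> by simp
  next
    case (Cons j p')
    then have j: "j < length (children \<phi>)" "subform_at (children \<phi> ! j) p' = Some \<chi>"
      using p by (auto split: if_splits)
    then have "j = i" using others[of j] plain_subform \<chi>(1) by blast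
    then show ?thesis using j i Cons by simp
  qed
  show ?thesis unfolding has_entry_def
  proof (intro exI[of _ "i # q"] conjI allI impI)
    show "subform_at \<phi> (i # q) = Some (Label 0 \<beta>)" using q(1) i by simp
  next
    fix p k assume "subform_at \<phi> p = Some (JumpAt k)"
    from sub[OF this] obtain p' where "p = i # p'" "subform_at \<psi> p' = Some (JumpAt k)"
      using \<phi>(2)[of k] by auto
    then show "k = 0" "prefix (i # q) p" using q(2) by auto
  next
    fix p k \<chi> assume "subform_at \<phi> p = Some (Label k \<chi>)"
    from sub[OF this] obtain p' where "p = i # p'" "subform_at \<psi> p' = Some (Label k \<chi>)"
      using \<phi>(1)[of k \<chi>] by auto
    then show "p = i # q" using q(3) by auto
  qed
qed

text \<open>Pins are left conjuncts and continuations right ones, so for \<open>Conj\<close> the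
  entry is child 1.\<close>

lemma has_entry_intros:
  assumes "has_entry \<psi> \<beta>"
  shows "plain {} \<theta> \<Longrightarrow> has_entry (Conj \<theta> \<psi>) \<beta>"
    and "has_entry (Exists x \<psi>) \<beta>" and "has_entry (InsElem x \<psi>) \<beta>"
    and "has_entry (InsRel R xs \<psi>) \<beta>" and "has_entry (InsVar X xs \<psi>) \<beta>"
    and "has_entry (DelRel R xs \<psi>) \<beta>" and "has_entry (DelVar X xs \<psi>) \<beta>"
  by (rule has_entry_child[OF assms, where i = 1]; auto simp: less_Suc_eq)
    (rule has_entry_child[OF assms, where i = 0]; simp)+

lemma has_entry_standard: "has_entry \<phi> \<beta> \<Longrightarrow> \<not> nonstandard_jump \<phi>"
  unfolding has_entry_def nonstandard_jump_def by blast

lemma has_entry_targets: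
  assumes "has_entry \<phi> \<beta>"
  shows "jump_targets \<phi> k = (if k = 0 then {Label 0 \<beta>} else {})"
proof -
  obtain q where q: "subform_at \<phi> q = Some (Label 0 \<beta>)"
    "\<And>p k \<chi>. subform_at \<phi> p = Some (Label k \<chi>) \<Longrightarrow> p = q"
    using assms unfolding has_entry_def by blast
  have "(\<exists>p. subform_at \<phi> p = Some (Label k \<chi>)) \<longleftrightarrow> k = 0 \<and> \<chi> = \<beta>" for \<chi>
  proof
    assume "\<exists>p. subform_at \<phi> p = Some (Label k \<chi>)"
    then have "subform_at \<phi> q = Some (Label k \<chi>)" using q(2) by metis
    then show "k = 0 \<and> \<chi> = \<beta>" using q(1) by simp
  qed (use q(1) in blast)
  then show ?thesis unfolding jump_targets_def by simp
qed

section \<open>The formula of a machine\<close>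

text \<open>Variables serve as registers that survive jumps: head cell, state, leftmost and rightmost
  cell; the other three are scratch.  The value of \<open>vS\<close> is that of one of the code variables \<open>v (Inl q)\<close>.
  The blank and the auxiliary symbols are written on cells by the relation variable \<open>T\<close>, which pairs
  a cell with the value of \<open>v (Inr t)\<close>; the input symbols by the relations \<open>P a\<close>.\<close>

abbreviation (input) "vH \<equiv> 0 :: var"
abbreviation (input) "vS \<equiv> 1 :: var"
abbreviation (input) "vL \<equiv> 2 :: var"
abbreviation (input) "vR \<equiv> 3 :: var"
abbreviation (input) "vN \<equiv> 4 :: var"
abbreviation (input) "vU \<equiv> 5 :: var"
abbreviation (input) "vU' \<equiv> 6 :: var"
abbreviation (input) "T \<equiv> RelVar 2 0"

type_synonym ('q, 'a, 'g) code = "'q + ('a, 'g) tape_symbol"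

locale simulation =
  fixes \<Sigma> :: "'a set" and M :: "('q, 'a, 'g) tm"
    and v :: "('q, 'a, 'g) code \<Rightarrow> var" and ks :: "('q, 'a, 'g) code list"
    and qts :: "('q \<times> ('a, 'g) tape_symbol) list"
  assumes M: "turing_machine \<Sigma> M"
    and ks: "set ks = states M <+> tape_alphabet \<Sigma> M" "distinct ks"
    and qts: "set qts = states M \<times> tape_alphabet \<Sigma> M"
    and inj_v: "inj_on v (set ks)"
    and v_ge: "\<And>k. 7 \<le> v k"
begin

primrec put :: "('a, 'g) tape_symbol \<Rightarrow> var \<Rightarrow> 'a word_symbol form \<Rightarrow> 'a word_symbol form" where
  "put (Inp a) x \<psi> = InsRel (P a) [vU] (Conj (same1 vU x) \<psi>)"
| "put Blank x \<psi> = InsVar T [vU, vU'] (Conj (same2 vU vU' x (v (Inr Blank))) \<psi>)"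
| "put (Aux b) x \<psi> = InsVar T [vU, vU'] (Conj (same2 vU vU' x (v (Inr (Aux b)))) \<psi>)"

primrec erase :: "('a, 'g) tape_symbol \<Rightarrow> var \<Rightarrow> 'a word_symbol form \<Rightarrow> 'a word_symbol form" where
  "erase (Inp a) x \<psi> = DelRel (P a) [vU] (Conj (same1 vU x) \<psi>)"
| "erase Blank x \<psi> = DelVar T [vU, vU'] (Conj (same2 vU vU' x (v (Inr Blank))) \<psi>)"
| "erase (Aux b) x \<psi> = DelVar T [vU, vU'] (Conj (same2 vU vU' x (v (Inr (Aux b)))) \<psi>)"

primrec holds_sym :: "('a, 'g) tape_symbol \<Rightarrow> 'a word_symbol form" where
  "holds_sym (Inp a) = RelAt (P a) [vH]"
| "holds_sym Blank = VarAt T [vH, v (Inr Blank)]"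
| "holds_sym (Aux b) = VarAt T [vH, v (Inr (Aux b))]"

text \<open>The tape is extended unconditionally on every step, so that the neighbours of the head
  always exist and no case distinction is needed, which would duplicate the formula after the move.\<close>

definition extend_right :: "'a word_symbol form \<Rightarrow> 'a word_symbol form" where
  "extend_right \<psi> = InsElem vN (InsRel Succ [vU, vU'] (Conj (same2 vU vU' vR vN)
     (Exists vR (Conj (EqAt vR vN) (put Blank vR \<psi>)))))"

definition extend_left :: "'a word_symbol form \<Rightarrow> 'a word_symbol form" where
  "extend_left \<psi> = InsElem vN (InsRel Succ [vU, vU'] (Conj (same2 vU vU' vN vL)
     (Exists vL (Conj (EqAt vL vN) (put Blank vL \<psi>)))))"

text \<open>Two quantifiers, because the pin for the new cell still refers to the old value of
  \<open>vH\<close>.\<close>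

primrec move :: "direction \<Rightarrow> 'a word_symbol form \<Rightarrow> 'a word_symbol form" where
  "move Stay \<psi> = \<psi>"
| "move Right \<psi> = Exists vN (Conj (RelAt Succ [vH, vN]) (Exists vH (Conj (EqAt vH vN) \<psi>)))"
| "move Left \<psi> = Exists vN (Conj (RelAt Succ [vN, vH]) (Exists vH (Conj (EqAt vH vN) \<psi>)))"

definition enter :: "'q \<Rightarrow> 'a word_symbol form \<Rightarrow> 'a word_symbol form" where
  "enter q \<psi> = Exists vS (Conj (EqAt vS (v (Inl q))) \<psi>)"

definition verum :: "'a word_symbol form" where
  "verum = EqAt vH vH"

definition guard :: "'q \<times> ('a, 'g) tape_symbol \<Rightarrow> 'a word_symbol form" where
  "guard qt = Conj (EqAt vS (v (Inl (fst qt)))) (holds_sym (snd qt))"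

text \<open>Halting branches end in truth or falsity, so Eloise wins with \<open>Plus\<close> at
  acceptance and with \<open>Minus\<close> at rejection. The scanned symbol is erased before the new
  one is written; otherwise a cell could satisfy several guards.\<close>

definition branch :: "'q \<times> ('a, 'g) tape_symbol \<Rightarrow> 'a word_symbol form" where
  "branch qt = (case delta M qt of
      None \<Rightarrow> if fst qt \<in> accepting M then verum else Neg verum
    | Some (q', t', d) \<Rightarrow> erase (snd qt) vH (put t' vH (move d (enter q' (JumpAt 0)))))"

definition body :: "'a word_symbol form" where
  "body = extend_right (extend_left
     (foldr Conj (map (\<lambda>qt. cond (guard qt) (branch qt)) qts) verum))"

text \<open>The element 0 of the word model, which carries no letter, becomes the blank cell \<open>- 1\<close>.\<close>

definition prelude :: "'a word_symbol form \<Rightarrow> 'a word_symbol form" where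
  "prelude \<psi> = Exists vL (Conj (Neg (Exists vN (RelAt Succ [vN, vL])))
     (Exists vR (Conj (Neg (Exists vN (RelAt Succ [vR, vN])))
     (foldr (\<lambda>k. InsElem (v k)) ks
     (enter (initial M) (Exists vH (Conj (EqAt vH vL)
     (DelVar T [vU, vU'] (Conj (same2 vU vU' vH vH)
     (put Blank vH (extend_right (move Right \<psi>))))))))))))"

section \<open>Simulation\<close>

text \<open>\<open>e\<close> sends the cells \<open>lo..hi\<close> to elements and \<open>y\<close> sends codes to elements.  Between the
  erasure of a symbol and the writing of the next one a cell carries no symbol, hence the tape
  content is a relation \<open>C\<close>.\<close>

definition enc :: "int \<Rightarrow> int \<Rightarrow> (int \<Rightarrow> nat) \<Rightarrow> (('q, 'a, 'g) code \<Rightarrow> nat) \<Rightarrow>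
    (int \<times> ('a, 'g) tape_symbol) set \<Rightarrow> int \<Rightarrow> 'q \<Rightarrow>
    ('a word_symbol, nat) model \<Rightarrow> nat assignment \<Rightarrow> bool" where
  "enc lo hi e y C h q B g \<longleftrightarrow>
     finite (universe B) \<and> inj_on e {lo..hi} \<and> e ` {lo..hi} \<subseteq> universe B \<and>
     inj_on y (set ks) \<and> y ` set ks \<subseteq> universe B \<and> (\<forall>k\<in>set ks. elem_of g (v k) = Some (y k)) \<and>
     interp B Succ = (\<lambda>i. [e i, e (i + 1)]) ` {lo..<hi} \<and>
     (\<forall>a\<in>\<Sigma>. interp B (P a) = (\<lambda>i. [e i]) ` {i. (i, Inp a) \<in> C}) \<and>
     rel_of g T = Some ((\<lambda>(i, t). [e i, y (Inr t)]) ` {(i, t). (i, t) \<in> C \<and> t \<notin> range Inp}) \<and>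
     C \<subseteq> {lo..hi} \<times> tape_alphabet \<Sigma> M \<and> lo \<le> h \<and> h \<le> hi \<and> q \<in> states M \<and>
     elem_of g vH = Some (e h) \<and> elem_of g vS = Some (y (Inl q)) \<and>
     elem_of g vL = Some (e lo) \<and> elem_of g vR = Some (e hi)"

section \<open>Effect of the single operations on an encoded tape\<close>

lemma v_neq [simp]: "k < 7 \<Longrightarrow> v c \<noteq> k" "k < 7 \<Longrightarrow> k \<noteq> v c"
  using v_ge[of c] by auto

lemma code_simps [simp]:
  "Inl q \<in> set ks \<longleftrightarrow> q \<in> states M" "Inr t \<in> set ks \<longleftrightarrow> t \<in> tape_alphabet \<Sigma> M"
  by (auto simp: ks)

lemma Blank_in [simp]: "Blank \<in> tape_alphabet \<Sigma> M"
  by (simp add: tape_alphabet_def)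

lemma Inp_in [simp]: "Inp a \<in> tape_alphabet \<Sigma> M \<longleftrightarrow> a \<in> \<Sigma>"
  by (auto simp: tape_alphabet_def)

text \<open>The image of \<open>C\<close> under the encoding gains the image of
  \<open>(j, t)\<close>. The bound on \<open>x\<close> keeps it apart from the scratch variables
  that the insertion rebinds; \<open>j\<close> is arbitrary because symbols are written at the head
  and at both ends.\<close>

lemma put_sound:
  assumes enc: "enc lo hi e y C h q B g" and x: "x < 5" "elem_of g x = Some (e j)"
    and j: "lo \<le> j" "j \<le> hi" and t: "t \<in> tape_alphabet \<Sigma> M"
  shows "\<exists>B' g'. enc lo hi e y (insert (j, t) C) h q B' g' \<and>
    (\<forall>K \<psi> s. ev K (put t x \<psi>) s B g \<longleftrightarrow> ev K \<psi> s B' g')"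
proof -
  have ej: "e j \<in> universe B" using enc j by (auto simp: enc_def)
  consider (inp) a where "t = Inp a" | (other) "t \<notin> range Inp" by blast
  then show ?thesis
  proof cases
    case inp
    let ?B = "set_interp B (P a) (insert [e j] (interp B (P a)))"
    have "\<And>K \<psi> s. ev K (put t x \<psi>) s B g \<longleftrightarrow> ev K \<psi> s ?B (assign g [vU] [e j])"
      unfolding inp put.simps by (rule ev_InsRel1[OF x(2) ej]) (use x in simp)
    moreover have "enc lo hi e y (insert (j, t) C) h q ?B (assign g [vU] [e j])"
      using enc j t unfolding enc_def by (auto simp: inp)
    ultimately show ?thesis by blast
  next
    case other
    have p: "put t x \<psi> = InsVar T [vU, vU'] (Conj (same2 vU vU' x (v (Inr t))) \<psi>)" for \<psi>
      using other by (cases t) auto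
    let ?g = "assign_rel (assign g [vU, vU'] [e j, y (Inr t)]) T
      (insert [e j, y (Inr t)] (rel_or_empty g T))"
    have yt: "elem_of g (v (Inr t)) = Some (y (Inr t))" "y (Inr t) \<in> universe B"
      using enc t by (auto simp: enc_def)
    have "\<And>K \<psi> s. ev K (put t x \<psi>) s B g \<longleftrightarrow> ev K \<psi> s B ?g"
      unfolding p by (rule ev_InsVar2[OF x(2) yt(1) ej yt(2)]) (use x in simp_all)
    moreover have "{(i, u). (i, u) \<in> insert (j, t) C \<and> u \<notin> range Inp} =
        insert (j, t) {(i, u). (i, u) \<in> C \<and> u \<notin> range Inp}"
      and "{i. (i, Inp a) \<in> insert (j, t) C} = {i. (i, Inp a) \<in> C}" for a
      using other by auto
    then have "enc lo hi e y (insert (j, t) C) h q B ?g"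
      using enc j t unfolding enc_def by (simp add: rel_or_empty_def)
    ultimately show ?thesis by blast
  qed
qed

text \<open>Unlike insertion, deletion relies on injectivity: the removed tuple must encode no pair
  other than \<open>(h, t)\<close>.\<close>

lemma erase_sound:
  assumes enc: "enc lo hi e y C h q B g" and t: "t \<in> tape_alphabet \<Sigma> M"
  shows "\<exists>B' g'. enc lo hi e y (C - {(h, t)}) h q B' g' \<and>
    (\<forall>K \<psi> s. ev K (erase t vH \<psi>) s B g \<longleftrightarrow> ev K \<psi> s B' g')"
proof -
  have ej: "e h \<in> universe B" and x: "elem_of g vH = Some (e h)"
    and inj: "inj_on e {lo..hi}" and C: "C \<subseteq> {lo..hi} \<times> tape_alphabet \<Sigma> M" and h: "h \<in> {lo..hi}"
    and inj_y: "inj_on y (set ks)"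
    using enc by (auto simp: enc_def)
  consider (inp) a where "t = Inp a" | (other) "t \<notin> range Inp" by blast
  then show ?thesis
  proof cases
    case inp
    let ?B = "set_interp B (P a) (interp B (P a) - {[e h]})"
    have "\<And>K \<psi> s. ev K (erase t vH \<psi>) s B g \<longleftrightarrow> ev K \<psi> s ?B (assign g [vU] [e h])"
      unfolding inp erase.simps by (rule ev_DelRel1[OF x ej]) simp
    moreover have "enc lo hi e y (C - {(h, t)}) h q ?B (assign g [vU] [e h])"
    proof -
      have "(\<lambda>i. [e i]) ` {i. (i, Inp a) \<in> C} - {[e h]} = (\<lambda>i. [e i]) ` {i. (i, Inp a) \<in> C - {(h, t)}}"
        using C h inj by (auto simp: inp inj_on_def)
      then show ?thesis using enc t unfolding enc_def by (auto simp: inp)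
    qed
    ultimately show ?thesis by blast
  next
    case other
    have p: "erase t vH \<psi> = DelVar T [vU, vU'] (Conj (same2 vU vU' vH (v (Inr t))) \<psi>)" for \<psi>
      using other by (cases t) auto
    let ?g = "assign_rel (assign g [vU, vU'] [e h, y (Inr t)]) T
      (rel_or_empty g T - {[e h, y (Inr t)]})"
    have yt: "elem_of g (v (Inr t)) = Some (y (Inr t))" "y (Inr t) \<in> universe B"
      using enc t by (auto simp: enc_def)
    have "\<And>K \<psi> s. ev K (erase t vH \<psi>) s B g \<longleftrightarrow> ev K \<psi> s B ?g"
      unfolding p by (rule ev_DelVar2[OF x yt(1) ej yt(2)]) simp_all
    moreover have "enc lo hi e y (C - {(h, t)}) h q B ?g"
    proof -
      have "inj_on (\<lambda>(i, t). [e i, y (Inr t)]) ({lo..hi} \<times> tape_alphabet \<Sigma> M)"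
      proof (rule inj_onI)
        fix p p'
        assume "p \<in> {lo..hi} \<times> tape_alphabet \<Sigma> M" "p' \<in> {lo..hi} \<times> tape_alphabet \<Sigma> M"
          "(\<lambda>(i, t). [e i, y (Inr t)]) p = (\<lambda>(i, t). [e i, y (Inr t)]) p'"
        then show "p = p'"
          using inj_onD[OF inj, of "fst p" "fst p'"] inj_onD[OF inj_y, of "Inr (snd p)" "Inr (snd p')"]
          by (simp add: case_prod_beta mem_Times_iff prod_eq_iff)
      qed
      then have "(\<lambda>(i, t). [e i, y (Inr t)]) ` ({(i, t). (i, t) \<in> C \<and> t \<notin> range Inp} - {(h, t)}) =
          (\<lambda>(i, t). [e i, y (Inr t)]) ` {(i, t). (i, t) \<in> C \<and> t \<notin> range Inp} -
          (\<lambda>(i, t). [e i, y (Inr t)]) ` {(h, t)}"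
        by (rule inj_on_image_set_diff) (use C h t in auto)
      moreover have "{(i, u). (i, u) \<in> C - {(h, t)} \<and> u \<notin> range Inp} =
          {(i, t). (i, t) \<in> C \<and> t \<notin> range Inp} - {(h, t)}"
        and "{i. (i, Inp a) \<in> C - {(h, t)}} = {i. (i, Inp a) \<in> C}" for a
        using other by auto
      moreover have "C - {(h, t)} \<subseteq> {lo..hi} \<times> tape_alphabet \<Sigma> M" using C by blast
      ultimately show ?thesis
        using enc unfolding enc_def by (simp add: rel_or_empty_def)
    qed
    ultimately show ?thesis by blast
  qed
qed

text \<open>Values of \<open>e\<close> outside the window are irrelevant, so a future cell can be
  given its element before the model is extended.\<close>

lemma enc_cong:
  assumes "\<And>i. lo \<le> i \<Longrightarrow> i \<le> hi \<Longrightarrow> e i = e' i"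
  shows "enc lo hi e y C h q B g \<Longrightarrow> enc lo hi e' y C h q B g"
proof -
  assume enc: "enc lo hi e y C h q B g"
  then have C: "C \<subseteq> {lo..hi} \<times> tape_alphabet \<Sigma> M" and lh: "lo \<le> h" "h \<le> hi" by (auto simp: enc_def)
  have "inj_on e {lo..hi} \<longleftrightarrow> inj_on e' {lo..hi}" "e ` {lo..hi} = e' ` {lo..hi}"
    "(\<lambda>i. [e i, e (i + 1)]) ` {lo..<hi} = (\<lambda>i. [e' i, e' (i + 1)]) ` {lo..<hi}"
    using assms by (auto intro!: inj_on_cong image_cong)
  moreover have "(\<lambda>i. [e i]) ` {i. (i, Inp a) \<in> C} = (\<lambda>i. [e' i]) ` {i. (i, Inp a) \<in> C}" for a
    using C assms by (intro image_cong) auto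
  moreover have "(\<lambda>(i, t). [e i, y (Inr t)]) ` {(i, t). (i, t) \<in> C \<and> t \<notin> range Inp} =
      (\<lambda>(i, t). [e' i, y (Inr t)]) ` {(i, t). (i, t) \<in> C \<and> t \<notin> range Inp}"
    using C assms by (intro image_cong) auto
  ultimately show "enc lo hi e' y C h q B g"
    using enc assms lh unfolding enc_def by simp
qed

lemma fresh_notin: "finite A \<Longrightarrow> fresh (A :: nat set) \<notin> A"
  unfolding fresh_def by (rule someI_ex) (metis ex_new_if_finite infinite_UNIV_nat)

lemma extend_right_sound:
  assumes enc: "enc lo hi e y C h q B g"
  shows "\<exists>B' g' e'. enc lo (hi + 1) e' y (insert (hi + 1, Blank) C) h q B' g' \<and>
    (\<forall>K \<psi> s. ev K (extend_right \<psi>) s B g \<longleftrightarrow> ev K \<psi> s B' g')"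
proof -
  define b where "b = fresh (universe B)"
  have b: "b \<notin> universe B" using enc unfolding b_def by (intro fresh_notin) (simp add: enc_def)
  define e1 where "e1 = e(hi + 1 := b)"
  have e1: "e1 (hi + 1) = b" by (simp add: e1_def)
  have enc1: "enc lo hi e1 y C h q B g" by (rule enc_cong[OF _ enc]) (simp add: e1_def)
  then have hi: "e1 hi \<in> universe B" "elem_of g vR = Some (e1 hi)" "lo \<le> hi"
    by (auto simp: enc_def)
  have U: "e1 ` {lo..hi} \<subseteq> universe B" using enc1 by (simp add: enc_def)
  let ?B1 = "B\<lparr>universe := insert b (universe B)\<rparr>"
  let ?B2 = "set_interp ?B1 Succ (insert [e1 hi, b] (interp ?B1 Succ))"
    and ?g2 = "assign (assign (assign g [vN] [b]) [vU, vU'] [e1 hi, b]) [vR] [b]"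
  have ev: "ev K (extend_right \<psi>) s B g \<longleftrightarrow> ev K (put Blank vR \<psi>) s ?B2 ?g2" for K \<psi> s
  proof -
    have "ev K (extend_right \<psi>) s B g \<longleftrightarrow> ev K (Exists vR (Conj (EqAt vR vN) (put Blank vR \<psi>)))
        s ?B2 (assign (assign g [vN] [b]) [vU, vU'] [e1 hi, b])"
      unfolding extend_right_def ev.simps(8) b_def[symmetric]
      by (rule ev_InsRel2) (use hi in simp_all)
    also have "\<dots> \<longleftrightarrow> ev K (put Blank vR \<psi>) s ?B2 ?g2"
      by (rule ev_Exists_EqAt) simp_all
    finally show ?thesis .
  qed
  have "{lo..hi + 1} = insert (hi + 1) {lo..hi}" "{lo..<hi + 1} = insert hi {lo..<hi}"
    using hi by auto
  moreover have "b \<notin> e1 ` {lo..hi}" using U b by blast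
  moreover have "C \<subseteq> insert (hi + 1) {lo..hi} \<times> tape_alphabet \<Sigma> M" using enc1 unfolding enc_def by blast
  ultimately have "enc lo (hi + 1) e1 y C h q ?B2 ?g2"
    using enc1 e1 unfolding enc_def by (simp add: subset_insertI2)
  then have "\<exists>B' g'. enc lo (hi + 1) e1 y (insert (hi + 1, Blank) C) h q B' g' \<and>
      (\<forall>K \<psi> s. ev K (put Blank vR \<psi>) s ?B2 ?g2 \<longleftrightarrow> ev K \<psi> s B' g')"
    by (rule put_sound) (use hi e1 in simp_all)
  then show ?thesis unfolding ev by blast
qed

lemma extend_left_sound:
  assumes enc: "enc lo hi e y C h q B g"
  shows "\<exists>B' g' e'. enc (lo - 1) hi e' y (insert (lo - 1, Blank) C) h q B' g' \<and>
    (\<forall>K \<psi> s. ev K (extend_left \<psi>) s B g \<longleftrightarrow> ev K \<psi> s B' g')"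
proof -
  define b where "b = fresh (universe B)"
  have b: "b \<notin> universe B" using enc unfolding b_def by (intro fresh_notin) (simp add: enc_def)
  define e1 where "e1 = e(lo - 1 := b)"
  have e1: "e1 (lo - 1) = b" by (simp add: e1_def)
  have enc1: "enc lo hi e1 y C h q B g" by (rule enc_cong[OF _ enc]) (simp add: e1_def)
  then have lo: "e1 lo \<in> universe B" "elem_of g vL = Some (e1 lo)" "lo \<le> hi"
    by (auto simp: enc_def)
  have U: "e1 ` {lo..hi} \<subseteq> universe B" using enc1 by (simp add: enc_def)
  let ?B1 = "B\<lparr>universe := insert b (universe B)\<rparr>"
  let ?B2 = "set_interp ?B1 Succ (insert [b, e1 lo] (interp ?B1 Succ))"
    and ?g2 = "assign (assign (assign g [vN] [b]) [vU, vU'] [b, e1 lo]) [vL] [b]"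
  have ev: "ev K (extend_left \<psi>) s B g \<longleftrightarrow> ev K (put Blank vL \<psi>) s ?B2 ?g2" for K \<psi> s
  proof -
    have "ev K (extend_left \<psi>) s B g \<longleftrightarrow> ev K (Exists vL (Conj (EqAt vL vN) (put Blank vL \<psi>)))
        s ?B2 (assign (assign g [vN] [b]) [vU, vU'] [b, e1 lo])"
      unfolding extend_left_def ev.simps(8) b_def[symmetric]
      by (rule ev_InsRel2) (use lo in simp_all)
    also have "\<dots> \<longleftrightarrow> ev K (put Blank vL \<psi>) s ?B2 ?g2"
      by (rule ev_Exists_EqAt) simp_all
    finally show ?thesis .
  qed
  have "{lo - 1..hi} = insert (lo - 1) {lo..hi}" "{lo - 1..<hi} = insert (lo - 1) {lo..<hi}"
    using lo by auto
  moreover have "b \<notin> e1 ` {lo..hi}" using U b by blast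
  moreover have "C \<subseteq> insert (lo - 1) {lo..hi} \<times> tape_alphabet \<Sigma> M" using enc1 unfolding enc_def by blast
  ultimately have "enc (lo - 1) hi e1 y C h q ?B2 ?g2"
    using enc1 e1 unfolding enc_def by (simp add: subset_insertI2)
  then have "\<exists>B' g'. enc (lo - 1) hi e1 y (insert (lo - 1, Blank) C) h q B' g' \<and>
      (\<forall>K \<psi> s. ev K (put Blank vL \<psi>) s ?B2 ?g2 \<longleftrightarrow> ev K \<psi> s B' g')"
    by (rule put_sound) (use lo e1 in simp_all)
  then show ?thesis unfolding ev by blast
qed

text \<open>Injectivity of \<open>e\<close> makes the neighbour under \<open>Succ\<close> unique, so
  the choice of \<open>vN\<close> is pinned; the bounds on \<open>h + offset d\<close> make it
  exist.\<close>

lemma move_sound: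
  assumes enc: "enc lo hi e y C h q B g" and h: "lo \<le> h + offset d" "h + offset d \<le> hi"
  shows "\<exists>g'. enc lo hi e y C (h + offset d) q B g' \<and>
    (\<forall>K \<psi> s. ev K (move d \<psi>) s B g \<longleftrightarrow> ev K \<psi> s B g')"
proof -
  let ?b = "e (h + offset d)"
  have lh: "lo \<le> h" "h \<le> hi" and b: "?b \<in> universe B" and gH: "elem_of g vH = Some (e h)"
    and succ: "interp B Succ = (\<lambda>i. [e i, e (i + 1)]) ` {lo..<hi}"
    and inj: "inj_on e {lo..hi}" and U: "e ` {lo..hi} \<subseteq> universe B"
    using enc h by (auto simp: enc_def)
  let ?g = "assign (assign g [vN] [?b]) [vH] [?b]"
  have enc': "enc lo hi e y C (h + offset d) q B ?g" using enc h unfolding enc_def by simp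
  have inj': "e i = e j \<longleftrightarrow> i = j" if "lo \<le> i" "i \<le> hi" "lo \<le> j" "j \<le> hi" for i j
    using inj_onD[OF inj, of i j] that by auto
  show ?thesis
  proof (cases d)
    case Stay
    then show ?thesis using enc by auto
  next
    case Right
    have "[e h, c] \<in> interp B Succ \<longleftrightarrow> c = e (h + 1)" for c
      using h lh unfolding succ Right by (force simp: inj')
    then have "ev K (move d \<psi>) s B g \<longleftrightarrow> ev K \<psi> s B ?g" for K \<psi> s
      unfolding Right move.simps using b gH Right
      by (subst ev_Exists_pinned[where b\<^sub>0 = ?b]; (subst ev_Exists_EqAt[where b = ?b])?) simp_all
    with enc' show ?thesis by blast
  next
    case Left
    have "[c, e h] \<in> interp B Succ \<longleftrightarrow> c = e (h - 1)" for c
      using h lh unfolding succ Left by (force simp: inj')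
    then have "ev K (move d \<psi>) s B g \<longleftrightarrow> ev K \<psi> s B ?g" for K \<psi> s
      unfolding Left move.simps using b gH Left
      by (subst ev_Exists_pinned[where b\<^sub>0 = ?b]; (subst ev_Exists_EqAt[where b = ?b])?) simp_all
    with enc' show ?thesis by blast
  qed
qed

lemma enter_sound:
  assumes enc: "enc lo hi e y C h q B g" and q': "q' \<in> states M"
  shows "\<exists>g'. enc lo hi e y C h q' B g' \<and>
    (\<forall>K \<psi> s. ev K (enter q' \<psi>) s B g \<longleftrightarrow> ev K \<psi> s B g')"
proof -
  let ?g = "assign g [vS] [y (Inl q')]"
  have "elem_of g (v (Inl q')) = Some (y (Inl q'))" "y (Inl q') \<in> universe B"
    using enc q' by (auto simp: enc_def)
  then have "ev K (enter q' \<psi>) s B g \<longleftrightarrow> ev K \<psi> s B ?g" for K \<psi> s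
    unfolding enter_def by (intro ev_Exists_EqAt) simp_all
  moreover have "enc lo hi e y C h q' B ?g" using enc q' unfolding enc_def by simp
  ultimately show ?thesis by blast
qed

lemma holds_sym_sound:
  assumes enc: "enc lo hi e y C h q B g" and t: "t \<in> tape_alphabet \<Sigma> M"
  shows "ev K (holds_sym t) s B g \<longleftrightarrow> ((h, t) \<in> C \<longleftrightarrow> s = Plus)"
proof -
  have gH: "elem_of g vH = Some (e h)" and h: "lo \<le> h" "h \<le> hi"
    and inj: "inj_on e {lo..hi}" and C: "C \<subseteq> {lo..hi} \<times> tape_alphabet \<Sigma> M"
    and inj_y: "inj_on y (set ks)"
    using enc by (auto simp: enc_def)
  consider (inp) a where "t = Inp a" | (other) "t \<notin> range Inp" by blast
  then show ?thesis
  proof cases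
    case inp
    then have "interp B (P a) = (\<lambda>i. [e i]) ` {i. (i, Inp a) \<in> C}" using enc t by (auto simp: enc_def)
    then have "[e h] \<in> interp B (P a) \<longleftrightarrow> (h, t) \<in> C"
      using C h inj by (auto simp: inp dest: inj_onD)
    then show ?thesis by (simp add: inp gH)
  next
    case other
    have p: "holds_sym t = VarAt T [vH, v (Inr t)]" using other by (cases t) auto
    have r: "rel_of g T = Some ((\<lambda>(i, t). [e i, y (Inr t)]) ` {(i, t). (i, t) \<in> C \<and> t \<notin> range Inp})"
      and y: "elem_of g (v (Inr t)) = Some (y (Inr t))"
      using enc t by (auto simp: enc_def)
    have "[e h, y (Inr t)] \<in> (\<lambda>(i, t). [e i, y (Inr t)]) ` {(i, t). (i, t) \<in> C \<and> t \<notin> range Inp} \<longleftrightarrow> (h, t) \<in> C"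
    proof
      assume "[e h, y (Inr t)] \<in> (\<lambda>(i, t). [e i, y (Inr t)]) ` {(i, t). (i, t) \<in> C \<and> t \<notin> range Inp}"
      then obtain i u where i: "(i, u) \<in> C" "e h = e i" "y (Inr t) = y (Inr u)" by auto
      then have "i = h" "u = t"
        using inj_onD[OF inj, of h i] inj_onD[OF inj_y, of "Inr t" "Inr u"] C h t by auto
      with i show "(h, t) \<in> C" by simp
    qed (use other in force)
    then show ?thesis using r y gH by (simp add: p)
  qed
qed

text \<open>Injectivity of \<open>y\<close> separates the states, and the assumption on
  \<open>C\<close> says that the scanned cell carries exactly one symbol. Hence exactly one guard is
  true.\<close>

lemma guard_sound:
  assumes enc: "enc lo hi e y C h q B g" and C: "\<And>t. (h, t) \<in> C \<longleftrightarrow> t = u"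
    and qt: "qt \<in> states M \<times> tape_alphabet \<Sigma> M"
  shows "ev K (guard qt) s B g \<longleftrightarrow> (qt = (q, u) \<longleftrightarrow> s = Plus)"
proof -
  obtain q' t where [simp]: "qt = (q', t)" by (cases qt)
  have "y (Inl q') = y (Inl q) \<longleftrightarrow> q' = q"
    using enc qt inj_onD[of y "set ks" "Inl q'" "Inl q"] by (auto simp: enc_def)
  moreover have "elem_of g vS = Some (y (Inl q))" "elem_of g (v (Inl q')) = Some (y (Inl q'))"
    using enc qt by (auto simp: enc_def)
  ultimately show ?thesis
    using holds_sym_sound[OF enc, of t K s] qt C by (cases s) (auto simp: guard_def)
qed

lemma dispatch_sound:
  assumes enc: "enc lo hi e y C h q B g" and C: "\<And>t. (h, t) \<in> C \<longleftrightarrow> t = u"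
  shows "ev K (foldr Conj (map (\<lambda>qt. cond (guard qt) (branch qt)) qts) verum) s B g \<longleftrightarrow>
    ev K (branch (q, u)) s B g"
proof -
  have "(q, u) \<in> set qts" using enc C[of u] by (auto simp: qts enc_def)
  then show ?thesis
    by (subst ev_dispatch[where k\<^sub>0 = "(q, u)"])
      (use guard_sound[OF enc C] in \<open>auto simp: qts verum_def\<close>)
qed

section \<open>One machine step\<close>

text \<open>A finite window represents the two-way infinite tape because the rest is blank. It is
  quantified away, along with the elements used, since every step enlarges it.\<close>

definition enc_config :: "('q, 'a, 'g) config \<Rightarrow> ('a word_symbol, nat) model \<Rightarrow> nat assignment \<Rightarrow> bool" where
  "enc_config c B g \<longleftrightarrow> (\<exists>lo hi e y.
     enc lo hi e y ((\<lambda>i. (i, tape c i)) ` {lo..hi}) (head c) (state c) B g \<and>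
     (\<forall>i. i < lo \<or> hi < i \<longrightarrow> tape c i = Blank))"

text \<open>The strict inequalities are the gain: the head is now interior, so a move in any
  direction stays inside the window.\<close>

lemma extend_sound:
  assumes "enc_config c B g"
  shows "\<exists>lo hi e y B' g'. enc lo hi e y ((\<lambda>i. (i, tape c i)) ` {lo..hi}) (head c) (state c) B' g' \<and>
    (\<forall>i. i < lo \<or> hi < i \<longrightarrow> tape c i = Blank) \<and> lo < head c \<and> head c < hi \<and>
    (\<forall>K \<psi> s. ev K (extend_right (extend_left \<psi>)) s B g \<longleftrightarrow> ev K \<psi> s B' g')"
proof -
  obtain lo hi e y where
    enc: "enc lo hi e y ((\<lambda>i. (i, tape c i)) ` {lo..hi}) (head c) (state c) B g" and
    blank: "\<And>i. i < lo \<or> hi < i \<Longrightarrow> tape c i = Blank"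
    using assms unfolding enc_config_def by blast
  let ?C = "(\<lambda>i. (i, tape c i)) ` {lo..hi}"
  obtain B1 g1 e1 where
    enc1: "enc lo (hi + 1) e1 y (insert (hi + 1, Blank) ?C) (head c) (state c) B1 g1" and
    ev1: "\<And>K \<psi> s. ev K (extend_right \<psi>) s B g \<longleftrightarrow> ev K \<psi> s B1 g1"
    using extend_right_sound[OF enc] by blast
  obtain B2 g2 e2 where
    enc2: "enc (lo - 1) (hi + 1) e2 y (insert (lo - 1, Blank) (insert (hi + 1, Blank) ?C))
      (head c) (state c) B2 g2" and
    ev2: "\<And>K \<psi> s. ev K (extend_left \<psi>) s B1 g1 \<longleftrightarrow> ev K \<psi> s B2 g2"
    using extend_left_sound[OF enc1] by blast
  have lh: "lo \<le> head c" "head c \<le> hi" using enc by (auto simp: enc_def)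
  have "{lo - 1..hi + 1} = insert (lo - 1) (insert (hi + 1) {lo..hi})" using lh by auto
  then have "insert (lo - 1, Blank) (insert (hi + 1, Blank) ?C) = (\<lambda>i. (i, tape c i)) ` {lo - 1..hi + 1}"
    using blank by simp
  then show ?thesis using enc2 ev1 ev2 lh blank
    by (intro exI[of _ "lo - 1"] exI[of _ "hi + 1"] exI[of _ e2] exI[of _ y] exI[of _ B2] exI[of _ g2]) simp
qed

text \<open>\<open>B'\<close> and \<open>g'\<close> come before \<open>K\<close> and
  \<open>s\<close>: whatever value a jump is given, the step reaches the same position with the same
  sign.\<close>

lemma step_sound:
  assumes "enc_config c B g" and step: "tm_step M c c'"
  shows "\<exists>B' g'. enc_config c' B' g' \<and> (\<forall>K s. ev K (Label 0 body) s B g \<longleftrightarrow> K s B' g')"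
proof -
  obtain lo hi e y B1 g1 where
    enc1: "enc lo hi e y ((\<lambda>i. (i, tape c i)) ` {lo..hi}) (head c) (state c) B1 g1" and
    blank: "\<And>i. i < lo \<or> hi < i \<Longrightarrow> tape c i = Blank" and lh: "lo < head c" "head c < hi" and
    ev1: "\<And>K \<psi> s. ev K (extend_right (extend_left \<psi>)) s B g \<longleftrightarrow> ev K \<psi> s B1 g1"
    using extend_sound[OF assms(1)] by blast
  let ?t = "tape c (head c)" and ?C = "(\<lambda>i. (i, tape c i)) ` {lo..hi}"
  obtain q' t' d where delta: "delta M (state c, ?t) = Some (q', t', d)" and
    c': "c' = \<lparr>state = q', head = head c + offset d, tape = (tape c)(head c := t')\<rparr>"
    using step unfolding tm_step_def by blast
  then have q': "q' \<in> states M" and t': "t' \<in> tape_alphabet \<Sigma> M"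
    using M unfolding turing_machine_def by (blast dest: ranI)+
  have C: "(head c, t) \<in> ?C \<longleftrightarrow> t = ?t" for t using lh by auto
  have "?C \<subseteq> {lo..hi} \<times> tape_alphabet \<Sigma> M" using enc1 by (simp add: enc_def)
  then have t: "?t \<in> tape_alphabet \<Sigma> M" using C[of ?t] by blast
  obtain B2 g2 where enc2: "enc lo hi e y (?C - {(head c, ?t)}) (head c) (state c) B2 g2" and
    ev2: "\<And>K \<psi> s. ev K (erase ?t vH \<psi>) s B1 g1 \<longleftrightarrow> ev K \<psi> s B2 g2"
    using erase_sound[OF enc1 t] by blast
  have "elem_of g2 vH = Some (e (head c))" using enc2 by (simp add: enc_def)
  then obtain B3 g3 where
    enc3: "enc lo hi e y (insert (head c, t') (?C - {(head c, ?t)})) (head c) (state c) B3 g3" and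
    ev3: "\<And>K \<psi> s. ev K (put t' vH \<psi>) s B2 g2 \<longleftrightarrow> ev K \<psi> s B3 g3"
    using put_sound[OF enc2, of vH "head c" t'] lh t' by auto
  have off: "lo \<le> head c + offset d" "head c + offset d \<le> hi" using lh by (cases d; simp)+
  obtain g4 where
    enc4: "enc lo hi e y (insert (head c, t') (?C - {(head c, ?t)})) (head c + offset d) (state c) B3 g4" and
    ev4: "\<And>K \<psi> s. ev K (move d \<psi>) s B3 g3 \<longleftrightarrow> ev K \<psi> s B3 g4"
    using move_sound[OF enc3 off] by blast
  obtain g5 where
    enc5: "enc lo hi e y (insert (head c, t') (?C - {(head c, ?t)})) (head c + offset d) q' B3 g5" and
    ev5: "\<And>K \<psi> s. ev K (enter q' \<psi>) s B3 g4 \<longleftrightarrow> ev K \<psi> s B3 g5"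
    using enter_sound[OF enc4 q'] by blast
  have "insert (head c, t') (?C - {(head c, ?t)}) = (\<lambda>i. (i, tape c' i)) ` {lo..hi}"
    using lh by (auto simp: c' image_iff)
  then have "enc_config c' B3 g5"
    unfolding enc_config_def using enc5 blank lh
    by (intro exI[of _ lo] exI[of _ hi] exI[of _ e] exI[of _ y]) (auto simp: c')
  moreover have "ev K (Label 0 body) s B g \<longleftrightarrow> K s B3 g5" for K s
    using dispatch_sound[OF enc1 C, of K s]
    by (simp add: body_def ev1 branch_def delta ev2 ev3 ev4 ev5 del: fun_upd_apply)
  ultimately show ?thesis by blast
qed

text \<open>The selected branch contains no jump, so the value is the same for every
  \<open>K\<close>.\<close>

lemma halt_sound:
  assumes "enc_config c B g" and halt: "\<nexists>c'. tm_step M c c'"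
  shows "ev K (Label 0 body) s B g \<longleftrightarrow> (state c \<in> accepting M \<longleftrightarrow> s = Plus)"
proof -
  obtain lo hi e y B1 g1 where
    enc1: "enc lo hi e y ((\<lambda>i. (i, tape c i)) ` {lo..hi}) (head c) (state c) B1 g1" and
    lh: "lo < head c" "head c < hi" and
    ev1: "\<And>K \<psi> s. ev K (extend_right (extend_left \<psi>)) s B g \<longleftrightarrow> ev K \<psi> s B1 g1"
    using extend_sound[OF assms(1)] by blast
  have C: "(head c, t) \<in> (\<lambda>i. (i, tape c i)) ` {lo..hi} \<longleftrightarrow> t = tape c (head c)" for t
    using lh by auto
  have "delta M (state c, tape c (head c)) = None"
    using halt unfolding tm_step_def by (metis not_Some_eq prod_cases3)
  then show ?thesis using dispatch_sound[OF enc1 C, of K s]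
    by (cases s) (simp_all add: body_def ev1 branch_def verum_def)
qed

section \<open>The initial configuration\<close>

text \<open>That the codes lie outside the old domain carries the induction: later codes then differ
  from the one just inserted. Injectivity of \<open>v\<close> protects its variable from being
  overwritten.\<close>

lemma insert_codes_sound:
  assumes "finite (universe B)" and "distinct cs" and "inj_on v (set cs)"
  shows "\<exists>B' g' y. finite (universe B') \<and> universe B \<subseteq> universe B' \<and> interp B' = interp B \<and>
    rel_of g' = rel_of g \<and> y ` set cs \<subseteq> universe B' - universe B \<and> inj_on y (set cs) \<and>
    (\<forall>k\<in>set cs. elem_of g' (v k) = Some (y k)) \<and>
    (\<forall>x. x \<notin> v ` set cs \<longrightarrow> elem_of g' x = elem_of g x) \<and>
    (\<forall>K \<psi> s. ev K (foldr (\<lambda>k. InsElem (v k)) cs \<psi>) s B g \<longleftrightarrow> ev K \<psi> s B' (g' :: nat assignment))"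
  using assms
proof (induction cs arbitrary: B g)
  case Nil
  then show ?case by (intro exI[of _ B] exI[of _ g]) simp
next
  case (Cons c cs)
  define b where "b = fresh (universe B)"
  have b: "b \<notin> universe B" unfolding b_def by (rule fresh_notin) (rule Cons.prems)
  let ?B = "B\<lparr>universe := insert b (universe B)\<rparr>" and ?g = "assign g [v c] [b]"
  have "\<exists>B' g' y. finite (universe B') \<and> universe ?B \<subseteq> universe B' \<and> interp B' = interp ?B \<and>
    rel_of g' = rel_of ?g \<and> y ` set cs \<subseteq> universe B' - universe ?B \<and> inj_on y (set cs) \<and>
    (\<forall>k\<in>set cs. elem_of g' (v k) = Some (y k)) \<and>
    (\<forall>x. x \<notin> v ` set cs \<longrightarrow> elem_of g' x = elem_of ?g x) \<and>
    (\<forall>K \<psi> s. ev K (foldr (\<lambda>k. InsElem (v k)) cs \<psi>) s ?B ?g \<longleftrightarrow> ev K \<psi> s B' g')"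
    by (rule Cons.IH) (use Cons.prems in simp_all)
  then obtain B' g' y where fin: "finite (universe B')" and U: "universe ?B \<subseteq> universe B'"
    and i: "interp B' = interp ?B" and r: "rel_of g' = rel_of ?g"
    and y: "y ` set cs \<subseteq> universe B' - universe ?B" and inj: "inj_on y (set cs)"
    and gy: "\<forall>k\<in>set cs. elem_of g' (v k) = Some (y k)"
    and gx: "\<forall>x. x \<notin> v ` set cs \<longrightarrow> elem_of g' x = elem_of ?g x"
    and ev: "\<And>K \<psi> s. ev K (foldr (\<lambda>k. InsElem (v k)) cs \<psi>) s ?B ?g \<longleftrightarrow> ev K \<psi> s B' g'"
    by blast
  let ?y = "y(c := b)"
  have c: "c \<notin> set cs" and vc: "v c \<notin> v ` set cs" using Cons.prems(2,3) by simp_all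
  have img: "?y ` set cs = y ` set cs" using c by (intro image_cong) auto
  have b': "b \<notin> y ` set cs" using y by auto
  have "inj_on ?y (set cs) \<longleftrightarrow> inj_on y (set cs)" using c by (intro inj_on_cong) auto
  then have "inj_on ?y (set (c # cs))" using inj b' c img by (simp del: fun_upd_apply) simp
  moreover have "?y ` set (c # cs) \<subseteq> universe B' - universe B"
    using img y U b by (simp del: fun_upd_apply) (simp, blast)
  moreover have "elem_of g' (v c) = Some b" using gx vc by simp
  then have "\<forall>k\<in>set (c # cs). elem_of g' (v k) = Some (?y k)" using gy c by auto
  moreover have "\<forall>x. x \<notin> v ` set (c # cs) \<longrightarrow> elem_of g' x = elem_of g x" using gx by simp
  moreover have "\<forall>K \<psi> s. ev K (foldr (\<lambda>k. InsElem (v k)) (c # cs) \<psi>) s B g \<longleftrightarrow> ev K \<psi> s B' g'"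
    using ev by (simp add: b_def)
  ultimately show ?case using fin U i r
    by (intro exI[of _ B'] exI[of _ g'] exI[of _ ?y]) (simp del: fun_upd_apply)
qed

text \<open>The ends of the word are identified before the codes are created, as isolated elements
  would also lack a predecessor and a successor. The added cell \<open>n\<close> ensures that cell 0
  exists even for the empty word; the head reaches it by moving right from cell -1.\<close>

lemma prelude_sound:
  assumes w: "w \<in> lists \<Sigma>"
  shows "\<exists>B g. enc_config (initial_config M w) B g \<and>
    (\<forall>K \<psi> s. ev K (prelude \<psi>) s (word_model w) empty_assignment \<longleftrightarrow> ev K \<psi> s B g)"
proof -
  let ?W = "word_model w" and ?n = "length w"
  have U: "universe ?W = {0..?n}" by (simp add: word_model_def)
  have succ: "[b, c] \<in> interp ?W Succ \<longleftrightarrow> c = b + 1 \<and> b < ?n" for b c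
    by (auto simp: word_model_def)
  have q\<^sub>0: "initial M \<in> states M" using M by (simp add: turing_machine_def)
  let ?g1 = "assign empty_assignment [vL] [0]"
  have ev1: "ev K (Exists vL (Conj (Neg (Exists vN (RelAt Succ [vN, vL]))) \<psi>)) s ?W empty_assignment
      \<longleftrightarrow> ev K \<psi> s ?W ?g1" for K \<psi> s
  proof (rule ev_Exists_pinned)
    fix b assume b: "b \<in> universe ?W"
    have "(\<exists>c\<in>universe ?W. [c, b] \<in> interp ?W Succ) \<longleftrightarrow> b \<noteq> 0"
      using b by (cases b) (auto simp: succ U)
    then show "ev K (Neg (Exists vN (RelAt Succ [vN, vL]))) s ?W (assign empty_assignment [vL] [b]) \<longleftrightarrow>
        (b = 0 \<longleftrightarrow> s = Plus)"
      by (cases s) (auto simp: picks_def)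
  qed (simp add: U)
  let ?g2 = "assign ?g1 [vR] [?n]"
  have ev2: "ev K (Exists vR (Conj (Neg (Exists vN (RelAt Succ [vR, vN]))) \<psi>)) s ?W ?g1
      \<longleftrightarrow> ev K \<psi> s ?W ?g2" for K \<psi> s
  proof (rule ev_Exists_pinned)
    fix b assume b: "b \<in> universe ?W"
    have "(\<exists>c\<in>universe ?W. [b, c] \<in> interp ?W Succ) \<longleftrightarrow> b \<noteq> ?n"
      using b by (auto simp: succ U)
    then show "ev K (Neg (Exists vN (RelAt Succ [vR, vN]))) s ?W (assign ?g1 [vR] [b]) \<longleftrightarrow>
        (b = ?n \<longleftrightarrow> s = Plus)"
      by (cases s) (auto simp: picks_def)
  qed (simp add: U)
  have "finite (universe ?W)" by (simp add: U)
  from insert_codes_sound[OF this ks(2) inj_v, of ?g2] obtain B3 g3 y where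
    fin: "finite (universe B3)" and U3: "universe ?W \<subseteq> universe B3"
    and i3: "interp B3 = interp ?W" and r3: "rel_of g3 = rel_of ?g2"
    and y: "y ` set ks \<subseteq> universe B3 - universe ?W" and inj_y: "inj_on y (set ks)"
    and gy: "\<forall>k\<in>set ks. elem_of g3 (v k) = Some (y k)"
    and gx: "\<forall>x. x \<notin> v ` set ks \<longrightarrow> elem_of g3 x = elem_of ?g2 x"
    and ev3: "\<And>K \<psi> s. ev K (foldr (\<lambda>k. InsElem (v k)) ks \<psi>) s ?W ?g2 \<longleftrightarrow> ev K \<psi> s B3 g3"
    by blast
  have g3: "elem_of g3 vL = Some 0" "elem_of g3 vR = Some ?n" using gx by (auto simp: image_iff)
  have yU: "y ` set ks \<subseteq> universe B3" using y by blast
  have 0: "0 \<in> universe B3" using U3 U by auto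
  let ?g4 = "assign g3 [vS] [y (Inl (initial M))]"
  let ?g5 = "assign ?g4 [vH] [0]"
  \<comment> \<open>The deletion only serves to give \<open>T\<close> a value: \<open>T\<close> is
    still unassigned, hence read as empty, and stays empty after the removal.\<close>
  let ?g6 = "assign_rel (assign ?g5 [vU, vU'] [0, 0]) T (rel_or_empty ?g5 T - {[0, 0]})"
  have ev4: "ev K (enter (initial M) \<psi>) s B3 g3 \<longleftrightarrow> ev K \<psi> s B3 ?g4" for K \<psi> s
    unfolding enter_def using gy yU q\<^sub>0 by (intro ev_Exists_EqAt) auto
  have ev5: "ev K (Exists vH (Conj (EqAt vH vL) \<psi>)) s B3 ?g4 \<longleftrightarrow> ev K \<psi> s B3 ?g5" for K \<psi> s
    using g3 0 by (intro ev_Exists_EqAt) auto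
  have ev6: "ev K (DelVar T [vU, vU'] (Conj (same2 vU vU' vH vH) \<psi>)) s B3 ?g5 \<longleftrightarrow> ev K \<psi> s B3 ?g6"
    for K \<psi> s
    using 0 by (intro ev_DelVar2) auto
  \<comment> \<open>Letters sit on elements from 1 and on cells from 0, so cell \<open>i\<close> is
    element \<open>i + 1\<close>. Cell -1 carries no symbol yet; its blank is written next.\<close>
  let ?e = "\<lambda>i. nat (i + 1)" and ?C = "(\<lambda>i. (i, Inp (w ! nat i) :: ('a, 'g) tape_symbol)) ` {0..<int ?n}"
  have enc0: "enc (- 1) (int ?n - 1) ?e y ?C (- 1) (initial M) B3 ?g6"
  proof -
    have "inj_on ?e {- 1..int ?n - 1}" by (auto intro!: inj_onI)
    moreover have "?e ` {- 1..int ?n - 1} \<subseteq> universe B3" using U3 U by (auto simp: subset_iff)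
    moreover have "interp B3 Succ = (\<lambda>i. [?e i, ?e (i + 1)]) ` {- 1..<int ?n - 1}"
    proof -
      have "{[i, i + 1] | i. i < ?n} = (\<lambda>i. [?e i, ?e (i + 1)]) ` {- 1..<int ?n - 1}"
      proof (intro set_eqI iffI)
        fix x assume "x \<in> {[i, i + 1] | i. i < ?n}"
        then obtain i where "x = [i, i + 1]" "i < ?n" by blast
        then show "x \<in> (\<lambda>i. [?e i, ?e (i + 1)]) ` {- 1..<int ?n - 1}"
          by (intro image_eqI[of _ _ "int i - 1"]) auto
      next
        fix x assume "x \<in> (\<lambda>i. [?e i, ?e (i + 1)]) ` {- 1..<int ?n - 1}"
        then obtain i where "x = [?e i, ?e (i + 1)]" "- 1 \<le> i" "i < int ?n - 1" by auto
        then show "x \<in> {[i, i + 1] | i. i < ?n}"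
          by (intro CollectI exI[of _ "?e i"]) auto
      qed
      then show ?thesis by (simp add: i3 word_model_def)
    qed
    moreover have "interp B3 (P a) = (\<lambda>i. [?e i]) ` {i. (i, Inp a) \<in> ?C}" for a
    proof -
      have "{[i] | i. 1 \<le> i \<and> i \<le> ?n \<and> w ! (i - 1) = a} = (\<lambda>i. [?e i]) ` {i. (i, Inp a) \<in> ?C}"
      proof (intro set_eqI iffI)
        fix x assume "x \<in> {[i] | i. 1 \<le> i \<and> i \<le> ?n \<and> w ! (i - 1) = a}"
        then obtain i where i: "x = [i]" "1 \<le> i" "i \<le> ?n" "w ! (i - 1) = a" by blast
        then have "nat (int i - 1) = i - 1" by simp
        with i show "x \<in> (\<lambda>i. [?e i]) ` {i. (i, Inp a) \<in> ?C}"
          by (intro image_eqI[of _ _ "int i - 1"]) auto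
      next
        fix x assume "x \<in> (\<lambda>i. [?e i]) ` {i. (i, Inp a) \<in> ?C}"
        then obtain i where i: "x = [?e i]" "0 \<le> i" "i < int ?n" "w ! nat i = a" by auto
        then have "?e i - 1 = nat i" by simp
        with i show "x \<in> {[i] | i. 1 \<le> i \<and> i \<le> ?n \<and> w ! (i - 1) = a}"
          by (intro CollectI exI[of _ "?e i"]) auto
      qed
      then show ?thesis by (simp add: i3 word_model_def)
    qed
    moreover have "?C \<subseteq> {- 1..int ?n - 1} \<times> tape_alphabet \<Sigma> M"
      using w by (auto simp: lists_eq_set subset_iff)
    moreover have "{(i, t). (i, t) \<in> ?C \<and> t \<notin> range Inp} = {}" by auto
    moreover have "rel_or_empty ?g5 T = {}" by (simp add: rel_or_empty_def r3 empty_assignment_def)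
    ultimately show ?thesis
      using fin inj_y yU gy g3 q\<^sub>0 unfolding enc_def by simp
  qed
  have "\<exists>B' g'. enc (- 1) (int ?n - 1) ?e y (insert (- 1, Blank) ?C) (- 1) (initial M) B' g' \<and>
      (\<forall>K \<psi> s. ev K (put Blank vH \<psi>) s B3 ?g6 \<longleftrightarrow> ev K \<psi> s B' g')"
    by (rule put_sound[OF enc0]) simp_all
  then obtain B7 g7 where
    enc7: "enc (- 1) (int ?n - 1) ?e y (insert (- 1, Blank) ?C) (- 1) (initial M) B7 g7"
    and ev7: "\<And>K \<psi> s. ev K (put Blank vH \<psi>) s B3 ?g6 \<longleftrightarrow> ev K \<psi> s B7 g7" by blast
  obtain B8 g8 e8 where
    "enc (- 1) (int ?n - 1 + 1) e8 y (insert (int ?n - 1 + 1, Blank) (insert (- 1, Blank) ?C)) (- 1)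
      (initial M) B8 g8"
    and ev8: "\<And>K \<psi> s. ev K (extend_right \<psi>) s B7 g7 \<longleftrightarrow> ev K \<psi> s B8 g8"
    using extend_right_sound[OF enc7] by blast
  then have enc8: "enc (- 1) (int ?n) e8 y (insert (int ?n, Blank) (insert (- 1, Blank) ?C)) (- 1)
      (initial M) B8 g8" by simp
  obtain g9 where
    enc9: "enc (- 1) (int ?n) e8 y (insert (int ?n, Blank) (insert (- 1, Blank) ?C)) 0 (initial M) B8 g9"
    and ev9: "\<And>K \<psi> s. ev K (move Right \<psi>) s B8 g8 \<longleftrightarrow> ev K \<psi> s B8 g9"
    using move_sound[OF enc8, of Right] by auto
  have "insert (int ?n, Blank) (insert (- 1, Blank) ?C) =
      (\<lambda>i. (i, tape (initial_config M w) i)) ` {- 1..int ?n}"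
  proof -
    have "{- 1..int ?n} = insert (int ?n) (insert (- 1) {0..<int ?n})" by auto
    then show ?thesis by (simp add: initial_config_def)
  qed
  then have "enc_config (initial_config M w) B8 g9"
    unfolding enc_config_def using enc9
    by (intro exI[of _ "- 1"] exI[of _ "int ?n"] exI[of _ e8] exI[of _ y]) (simp add: initial_config_def)
  moreover have "ev K (prelude \<psi>) s ?W empty_assignment \<longleftrightarrow> ev K \<psi> s B8 g9" for K \<psi> s
    unfolding prelude_def ev1 ev2 ev3 ev4 ev5 ev6 ev7 ev8 ev9 ..
  ultimately show ?thesis by blast
qed

section \<open>Halting computations and winning\<close>

definition good :: "sign \<Rightarrow> ('q, 'a, 'g) config \<Rightarrow> bool" where
  "good s c \<longleftrightarrow> (\<exists>c'. (tm_step M)\<^sup>*\<^sup>* c c' \<and> (\<nexists>c''. tm_step M c' c'') \<and>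
     (state c' \<in> accepting M \<longleftrightarrow> s = Plus))"

text \<open>Backward induction along the computation: the value at the successor is turned into a
  win there by \<open>ev_imp_wins\<close>, and this win is the value of the jump that ends the
  step.\<close>

lemma good_imp_ev:
  assumes targets: "\<And>k. jump_targets \<phi> k = (if k = 0 then {Label 0 body} else {})"
    and "good s c" and "enc_config c B g"
  shows "ev (\<lambda>s B g. wins \<phi> Eloise (B, g, s, Label 0 body)) (Label 0 body) s B g"
proof -
  let ?K = "\<lambda>s B g. wins \<phi> Eloise (B, g, s, Label 0 body)"
  obtain c' where steps: "(tm_step M)\<^sup>*\<^sup>* c c'" and halt: "\<nexists>c''. tm_step M c' c''"
    and acc: "state c' \<in> accepting M \<longleftrightarrow> s = Plus" using assms(2) unfolding good_def by blast
  have "enc_config c B g \<longrightarrow> ev ?K (Label 0 body) s B g" for B g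
    using steps
  proof (induction arbitrary: B g rule: converse_rtranclp_induct)
    case base
    show ?case
    proof
      assume "enc_config c' B g"
      from halt_sound[OF this halt] acc show "ev ?K (Label 0 body) s B g" by blast
    qed
  next
    case (step c c1)
    show ?case
    proof
      assume "enc_config c B g"
      from step_sound[OF this step.hyps(1)] obtain B' g' where enc': "enc_config c1 B' g'"
        and ev: "\<And>K s. ev K (Label 0 body) s B g \<longleftrightarrow> K s B' g'" by blast
      have "ev ?K (Label 0 body) s B' g'" using step.IH enc' by blast
      then have "?K s B' g'" by (rule ev_imp_wins[OF targets])
      then show "ev ?K (Label 0 body) s B g" unfolding ev .
    qed
  qed
  then show ?thesis using assms(3) by blast
qed

text \<open>The closure condition of \<open>wins_imp_ev\<close>. All encoded configurations are
  considered because a position does not determine one: renumbering the cells by a shift gives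
  another.\<close>

lemma ev_imp_good:
  assumes "ev (\<lambda>s B g. \<forall>c. enc_config c B g \<longrightarrow> good s c) (Label 0 body) s B g"
    and enc: "enc_config c B g"
  shows "good s c"
proof (cases "\<exists>c'. tm_step M c c'")
  case True
  then obtain c' where c': "tm_step M c c'" by blast
  from step_sound[OF enc this] obtain B' g' where enc': "enc_config c' B' g'"
    and ev: "\<And>K s. ev K (Label 0 body) s B g \<longleftrightarrow> K s B' g'" by blast
  have "good s c'" using assms(1) enc' unfolding ev by blast
  then show ?thesis unfolding good_def using c' by (meson converse_rtranclp_into_rtranclp)
next
  case False
  then show ?thesis using halt_sound[OF enc] assms(1) unfolding good_def by blast
qed

lemma wins_prelude_iff:
  assumes targets: "\<And>k. jump_targets (prelude (Label 0 body)) k = (if k = 0 then {Label 0 body} else {})"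
    and w: "w \<in> lists \<Sigma>"
  shows "wins (prelude (Label 0 body)) Eloise (word_model w, empty_assignment, s, prelude (Label 0 body))
    \<longleftrightarrow> good s (initial_config M w)"
proof -
  obtain B g where enc: "enc_config (initial_config M w) B g" and
    ev: "\<And>K \<psi> s. ev K (prelude \<psi>) s (word_model w) empty_assignment \<longleftrightarrow> ev K \<psi> s B g"
    using prelude_sound[OF w] by blast
  show ?thesis
  proof
    assume win: "wins (prelude (Label 0 body)) Eloise (word_model w, empty_assignment, s, prelude (Label 0 body))"
    let ?K = "\<lambda>s B g. \<forall>c. enc_config c B g \<longrightarrow> good s c"
    have "ev_pos ?K (word_model w, empty_assignment, s, prelude (Label 0 body))"
      by (rule wins_imp_ev[OF targets _ win]) (use ev_imp_good in blast)
    then have "ev ?K (Label 0 body) s B g" by (simp only: ev_pos_def prod.case ev)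
    then show "good s (initial_config M w)" using ev_imp_good enc by blast
  next
    assume "good s (initial_config M w)"
    then show "wins (prelude (Label 0 body)) Eloise (word_model w, empty_assignment, s, prelude (Label 0 body))"
      by (intro ev_imp_wins[OF targets]) (simp only: ev good_imp_ev[OF targets _ enc])
  qed
qed

lemma good_iff:
  "good Plus (initial_config M w) \<longleftrightarrow> tm_accepts M w" "good Minus (initial_config M w) \<longleftrightarrow> tm_rejects M w"
  unfolding good_def tm_accepts_def tm_rejects_def halts_in_def by auto

section \<open>Syntactic conditions\<close>

text \<open>The condition on \<open>t\<close> matters through \<open>P a\<close>, which belongs to
  the vocabulary only for \<open>a\<close> in \<open>\<Sigma>\<close>.\<close>

lemma L_star_put [simp]:
  "t \<in> tape_alphabet \<Sigma> M \<Longrightarrow> L_star (word_vocab \<Sigma>) (put t x \<psi>) \<longleftrightarrow> L_star (word_vocab \<Sigma>) \<psi>"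
  by (cases t) (auto simp: word_vocab_def ok_relvar_def same1_def same2_def)

lemma L_star_erase [simp]:
  "t \<in> tape_alphabet \<Sigma> M \<Longrightarrow> L_star (word_vocab \<Sigma>) (erase t x \<psi>) \<longleftrightarrow> L_star (word_vocab \<Sigma>) \<psi>"
  by (cases t) (auto simp: word_vocab_def ok_relvar_def same1_def same2_def)

lemma L_star_holds_sym [simp]:
  "t \<in> tape_alphabet \<Sigma> M \<Longrightarrow> L_star (word_vocab \<Sigma>) (holds_sym t)"
  by (cases t) (auto simp: word_vocab_def ok_relvar_def)

lemma L_star_extend [simp]:
  "L_star (word_vocab \<Sigma>) (extend_right \<psi>) \<longleftrightarrow> L_star (word_vocab \<Sigma>) \<psi>"
  "L_star (word_vocab \<Sigma>) (extend_left \<psi>) \<longleftrightarrow> L_star (word_vocab \<Sigma>) \<psi>"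
  by (simp_all add: extend_right_def extend_left_def word_vocab_def ok_relvar_def same2_def)

lemma L_star_move [simp]: "L_star (word_vocab \<Sigma>) (move d \<psi>) \<longleftrightarrow> L_star (word_vocab \<Sigma>) \<psi>"
  by (cases d) (simp_all add: word_vocab_def)

lemma delta_range:
  assumes "delta M (q, t) = Some (q', t', d)"
  shows "q' \<in> states M" "t' \<in> tape_alphabet \<Sigma> M"
  using M assms unfolding turing_machine_def by (blast dest: ranI)+

lemma L_star_body: "L_star (word_vocab \<Sigma>) body"
proof -
  have "L_star (word_vocab \<Sigma>) (cond (guard qt) (branch qt))" if "qt \<in> set qts" for qt
  proof -
    obtain q t where qt: "qt = (q, t)" by (cases qt)
    have t: "t \<in> tape_alphabet \<Sigma> M" using that qts qt by simp
    have "L_star (word_vocab \<Sigma>) (branch qt)"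
      using t by (auto simp: branch_def qt verum_def enter_def delta_range split: option.split)
    then show ?thesis using t by (simp add: cond_def guard_def qt)
  qed
  then have "L_star (word_vocab \<Sigma>) (foldr Conj (map (\<lambda>qt. cond (guard qt) (branch qt)) xs) verum)"
    if "set xs \<subseteq> set qts" for xs
    using that by (induction xs) (simp_all add: verum_def)
  then show ?thesis by (simp add: body_def)
qed

lemma L_star_prelude: "L_star (word_vocab \<Sigma>) \<psi> \<Longrightarrow> L_star (word_vocab \<Sigma>) (prelude \<psi>)"
proof -
  assume "L_star (word_vocab \<Sigma>) \<psi>"
  moreover have "L_star \<sigma> (foldr (\<lambda>k. InsElem (v k)) cs \<chi>) \<longleftrightarrow> L_star \<sigma> \<chi>"
    for \<sigma> :: "'a word_symbol vocab" and cs \<chi>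
    by (induction cs) simp_all
  ultimately show ?thesis
    unfolding prelude_def by (simp add: word_vocab_def enter_def ok_relvar_def same2_def)
qed

section \<open>Free variables\<close>

lemma free_vars_put:
  "t \<in> tape_alphabet \<Sigma> M \<Longrightarrow> free_vars (put t x \<psi>) \<subseteq> insert x (v ` set ks) \<union> free_vars \<psi>"
  by (cases t) (auto simp: same1_def same2_def)

lemma free_vars_erase:
  "t \<in> tape_alphabet \<Sigma> M \<Longrightarrow> free_vars (erase t x \<psi>) \<subseteq> insert x (v ` set ks) \<union> free_vars \<psi>"
  by (cases t) (auto simp: same1_def same2_def)

lemma free_vars_holds_sym:
  "t \<in> tape_alphabet \<Sigma> M \<Longrightarrow> free_vars (holds_sym t) \<subseteq> insert vH (v ` set ks)"
  by (cases t) auto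

lemma free_vars_extend_right:
  "free_vars (extend_right \<psi>) \<subseteq> insert vR (v ` set ks) \<union> free_vars \<psi>"
  using free_vars_put[of Blank vR \<psi>] by (auto simp: extend_right_def same2_def)

lemma free_vars_extend_left:
  "free_vars (extend_left \<psi>) \<subseteq> insert vL (v ` set ks) \<union> free_vars \<psi>"
  using free_vars_put[of Blank vL \<psi>] by (auto simp: extend_left_def same2_def)

lemma free_vars_move: "free_vars (move d \<psi>) \<subseteq> insert vH (free_vars \<psi>)"
  by (cases d) auto

lemma free_vars_enter: "q \<in> states M \<Longrightarrow> free_vars (enter q \<psi>) \<subseteq> v ` set ks \<union> (free_vars \<psi> - {vS})"
  by (auto simp: enter_def)

text \<open>The bound consists of the variables that the prelude assigns for good; the scratch
  variables are bound anew before each use.\<close>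

lemma free_vars_body: "free_vars body \<subseteq> {vH, vS, vL, vR} \<union> v ` set ks"
proof -
  have "free_vars (cond (guard qt) (branch qt)) \<subseteq> {vH, vS} \<union> v ` set ks" if "qt \<in> set qts" for qt
  proof -
    obtain q t where qt: "qt = (q, t)" by (cases qt)
    have q: "q \<in> states M" and t: "t \<in> tape_alphabet \<Sigma> M" using that qts qt by simp_all
    have "free_vars (branch qt) \<subseteq> {vH, vS} \<union> v ` set ks"
    proof (cases "delta M qt")
      case None
      then show ?thesis by (simp add: branch_def verum_def)
    next
      case (Some r)
      obtain q' t' d where r: "r = (q', t', d)" by (cases r)
      have d: "q' \<in> states M" "t' \<in> tape_alphabet \<Sigma> M" using delta_range Some qt r by blast+
      have "branch qt = erase t vH (put t' vH (move d (enter q' (JumpAt 0))))"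
        using Some by (simp add: branch_def r qt)
      then show ?thesis
        using free_vars_erase[OF t, of vH "put t' vH (move d (enter q' (JumpAt 0)))"]
          free_vars_put[OF d(2), of vH "move d (enter q' (JumpAt 0))"]
          free_vars_move[of d "enter q' (JumpAt 0)"] free_vars_enter[OF d(1), of "JumpAt 0"]
        by auto
    qed
    moreover have "v (Inl q) \<in> v ` set ks" using q by simp
    ultimately show ?thesis using free_vars_holds_sym[OF t] by (auto simp: cond_def guard_def qt)
  qed
  then have "free_vars (foldr Conj (map (\<lambda>qt. cond (guard qt) (branch qt)) xs) verum)
      \<subseteq> {vH, vS} \<union> v ` set ks" if "set xs \<subseteq> set qts" for xs
    using that by (induction xs) (simp_all add: verum_def)
  from this[OF subset_refl] show ?thesis
    unfolding body_def
    using free_vars_extend_right[of "extend_left (foldr Conj (map (\<lambda>qt. cond (guard qt) (branch qt)) qts) verum)"]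
      free_vars_extend_left[of "foldr Conj (map (\<lambda>qt. cond (guard qt) (branch qt)) qts) verum"]
    by blast
qed

lemma free_vars_prelude:
  assumes "free_vars \<psi> \<subseteq> {vH, vS, vL, vR} \<union> v ` set ks"
  shows "free_vars (prelude \<psi>) = {}"
proof -
  have codes: "free_vars (foldr (\<lambda>k. InsElem (v k)) cs \<chi>) = free_vars \<chi> - v ` set cs"
    for cs and \<chi> :: "'a word_symbol form"
    by (induction cs) auto
  define \<chi> where "\<chi> = extend_right (move Right \<psi>)"
  have "free_vars \<chi> \<subseteq> {vH, vS, vL, vR} \<union> v ` set ks"
    unfolding \<chi>_def using assms free_vars_extend_right[of "move Right \<psi>"] free_vars_move[of Right \<psi>]
    by blast
  then have "free_vars (put Blank vH \<chi>) \<subseteq> {vH, vS, vL, vR} \<union> v ` set ks"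
    using free_vars_put[of Blank vH \<chi>] by auto
  moreover have "v (Inl (initial M)) \<in> v ` set ks" using M by (simp add: turing_machine_def)
  ultimately show ?thesis
    unfolding prelude_def \<chi>_def[symmetric] enter_def same2_def free_vars.simps codes by auto
qed

lemma free_relvars_put: "free_relvars (put t x \<psi>) \<subseteq> free_relvars \<psi>"
  by (cases t) (auto simp: same1_def same2_def)

lemma free_relvars_erase: "free_relvars (erase t x \<psi>) \<subseteq> free_relvars \<psi>"
  by (cases t) (auto simp: same1_def same2_def)

lemma free_relvars_extend:
  "free_relvars (extend_right \<psi>) \<subseteq> free_relvars \<psi>" "free_relvars (extend_left \<psi>) \<subseteq> free_relvars \<psi>"
  by (auto simp: extend_right_def extend_left_def same2_def)

lemma free_relvars_move [simp]: "free_relvars (move d \<psi>) = free_relvars \<psi>"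
  by (cases d) auto

lemma free_relvars_body: "free_relvars body \<subseteq> {T}"
proof -
  have "free_relvars (branch qt) \<subseteq> {}" for qt
    using free_relvars_erase[of "snd qt" vH] free_relvars_put[of _ vH "move _ (enter _ (JumpAt 0))"]
    by (auto simp: branch_def verum_def enter_def split: option.split) (blast dest: subsetD)+
  moreover have "free_relvars (holds_sym t) \<subseteq> {T}" for t
    by (cases t) auto
  ultimately have "free_relvars (cond (guard qt) (branch qt)) \<subseteq> {T}" for qt
    by (simp add: cond_def guard_def)
  then have "free_relvars (foldr Conj (map (\<lambda>qt. cond (guard qt) (branch qt)) xs) verum) \<subseteq> {T}" for xs
    by (induction xs) (simp_all add: verum_def)
  then show ?thesis unfolding body_def using free_relvars_extend by (meson subset_trans)
qed

lemma free_relvars_prelude: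
  assumes "free_relvars \<psi> \<subseteq> {T}"
  shows "free_relvars (prelude \<psi>) = {}"
proof -
  have codes: "free_relvars (foldr (\<lambda>k. InsElem (v k)) cs \<chi>) = free_relvars \<chi>"
    for cs and \<chi> :: "'a word_symbol form"
    by (induction cs) auto
  have "free_relvars (put Blank vH (extend_right (move Right \<psi>))) \<subseteq> {T}"
    using assms free_relvars_put[of Blank vH "extend_right (move Right \<psi>)"]
      free_relvars_extend(1)[of "move Right \<psi>"] by auto
  then show ?thesis
    unfolding prelude_def enter_def same2_def free_relvars.simps codes by auto
qed

section \<open>Labels and jumps\<close>

lemma plain_put [simp]: "plain J (put t x \<psi>) \<longleftrightarrow> plain J \<psi>"
  by (cases t) (auto simp: same1_def same2_def)

lemma plain_erase [simp]: "plain J (erase t x \<psi>) \<longleftrightarrow> plain J \<psi>"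
  by (cases t) (auto simp: same1_def same2_def)

lemma plain_body: "plain {0} body"
proof -
  have "plain {0} (branch qt)" for qt
  proof -
    have "plain {0} (move d (enter q (JumpAt 0)))" for d q by (cases d) (simp_all add: enter_def)
    then show ?thesis by (auto simp: branch_def verum_def split: option.split)
  qed
  moreover have "plain {0} (holds_sym t)" for t by (cases t) auto
  ultimately have "plain {0} (foldr Conj (map (\<lambda>qt. cond (guard qt) (branch qt)) xs) verum)" for xs
    by (induction xs) (simp_all add: verum_def cond_def guard_def)
  then show ?thesis by (simp add: body_def extend_right_def extend_left_def same2_def)
qed

lemma has_entry_put: "has_entry \<psi> b \<Longrightarrow> has_entry (put t x \<psi>) b"
  by (cases t) (auto simp: same1_def same2_def intro!: has_entry_intros)

lemma has_entry_prelude: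
  assumes "has_entry \<psi> b"
  shows "has_entry (prelude \<psi>) b"
proof -
  have codes: "has_entry (foldr (\<lambda>k. InsElem (v k)) cs \<chi>) b" if "has_entry \<chi> b"
    for cs and \<chi> :: "'a word_symbol form"
    using that by (induction cs) (auto intro: has_entry_intros)
  show ?thesis
    unfolding prelude_def enter_def same2_def extend_right_def move.simps
    by (intro has_entry_intros has_entry_put codes assms) simp_all
qed

end

theorem theorem1:
  fixes \<Sigma> :: "'a set" and TM :: "('q, 'a, 'g) tm"
  assumes "finite \<Sigma>" and "\<Sigma> \<noteq> {}" and "turing_machine \<Sigma> TM"
  shows "\<exists>\<phi> \<in> L (word_vocab \<Sigma>). sentence \<phi> \<and>
    (\<forall>w \<in> lists \<Sigma>. word_model w \<Turnstile>\<^sup>+ \<phi> \<longleftrightarrow> tm_accepts TM w) \<and>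
    (\<forall>w \<in> lists \<Sigma>. word_model w \<Turnstile>\<^sup>- \<phi> \<longleftrightarrow> tm_rejects TM w)"
proof -
  have fin: "finite (states TM)" "finite (tape_alphabet \<Sigma> TM)"
    using assms by (auto simp: turing_machine_def tape_alphabet_def)
  then have K: "finite (states TM <+> tape_alphabet \<Sigma> TM)" by simp
  obtain ks where ks: "set ks = states TM <+> tape_alphabet \<Sigma> TM" "distinct ks"
    using finite_distinct_list[OF K] by blast
  obtain qts where qts: "set qts = states TM \<times> tape_alphabet \<Sigma> TM"
    using finite_list[of "states TM \<times> tape_alphabet \<Sigma> TM"] fin by blast
  obtain f :: "('q, 'a, 'g) code \<Rightarrow> nat" where f: "inj_on f (set ks)"
    using finite_imp_inj_to_nat_seg[OF finite_set[of ks]] by blast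
  \<comment> \<open>The shift by 7 keeps the code variables apart from the registers and scratch
    variables 0 to 6.\<close>
  interpret simulation \<Sigma> TM "\<lambda>k. 7 + f k" ks qts
    by unfold_locales (use assms ks qts f in \<open>auto simp: inj_on_def\<close>)
  let ?\<phi> = "prelude (Label 0 body)"
  have entry: "has_entry ?\<phi> body"
    by (intro has_entry_prelude has_entry_Label plain_body)
  have "?\<phi> \<in> L (word_vocab \<Sigma>)"
    unfolding L_def using has_entry_standard[OF entry] L_star_prelude[of "Label 0 body"] L_star_body by simp
  moreover have "sentence ?\<phi>"
    unfolding sentence_def using free_vars_prelude[of "Label 0 body"] free_vars_body
      free_relvars_prelude[of "Label 0 body"] free_relvars_body by simp
  moreover have "(\<exists>S. winning_strategy ?\<phi> Eloise (word_model w, empty_assignment, s, ?\<phi>) S) \<longleftrightarrow>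
      good s (initial_config TM w)" if "w \<in> lists \<Sigma>" for w s
    using wins_prelude_iff[OF has_entry_targets[OF entry] that] wins_iff by metis
  ultimately show ?thesis
    by (intro bexI[of _ ?\<phi>]) (simp_all add: sat_pos_def sat_neg_def good_iff)
qed

end
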